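(* Consider a sequence of finite populations, indexed by the sample size $n\to\infty$, each satisfying the null hypothesis $H_0:\ T_i(1)=T_i(0)$ for all $i$, Assumption 1 and Assumption 2, and suppose Condition 2 holds. Then, conditioning on all potential event times, $U/\mathrm{Var}\{L\mid\boldsymbol{T}(1),\boldsymbol{T}(0)\}\xrightarrow{\Pr}1$ and $\mathrm{LR}=U^{-1/2}L$ satisfies $\mathrm{LR}\mid\boldsymbol{T}(1),\boldsymbol{T}(0)\xrightarrow{d}\mathcal{N}(0,1)$.
   Context: For a population of $n$ units: unit $i$ has potential event times $T_i(1),T_i(0)\ge 0$ (fixed constants), potential censoring times $C_i(1),C_i(0)\in[0,\infty]$, and treatment indicator $Z_i\in\{0,1\}$; bold letters denote $n$-vectors. Assumption 1: conditional on $\boldsymbol{T}(1),\boldsymbol{T}(0),\boldsymbol{C}(1),\boldsymbol{C}(0)$, the $Z_i$ are i.i.d. Bernoulli$(p_1)$, $p_1=1-p_0\in(0,1)$. Assumption 2: $(\boldsymbol{C}(1),\boldsymbol{C}(0))$ is independent of $(\boldsymbol{T}(1),\boldsymbol{T}(0))$ and the pairs $(C_i(1),C_i(0))$ are i.i.d. across $i$. Let $G_z(c)=\Pr(C_i(z)\ge c)$. Realized: $T_i=Z_iT_i(1)+(1-Z_i)T_i(0)$, $C_i=Z_iC_i(1)+(1-Z_i)C_i(0)$, $W_i=\min\{T_i,C_i\}$, $\Delta_i=\mathbb{1}(T_i\le C_i)$. Let $t_1<\dots<t_K$ be the distinct values of $\{T_i(0)\}$, $d_k=\#\{i:T_i(0)=t_k\}$,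 $n_k=\#\{i:T_i(0)\ge t_k\}$, $h_k=d_k/n_k$. For $1\le k\le K$: $N_{1k}=\sum_iZ_i\mathbb{1}(W_i\ge t_k)$, $N_{0k}=\sum_i(1-Z_i)\mathbb{1}(W_i\ge t_k)$, $N_k=N_{1k}+N_{0k}$, $D_{1k}=\sum_iZ_i\Delta_i\mathbb{1}(W_i=t_k)$, $D_k=\sum_i\Delta_i\mathbb{1}(W_i=t_k)$, $M_k=D_kN_{1k}/N_k$, $V_k=D_k(N_k-D_k)N_{1k}N_{0k}/\{N_k^2(N_k-1)\}$ (convention $0/0:=0$); $L=\sum_k(D_{1k}-M_k)$, $U=\sum_kV_k$. Quantities may depend on $n$. Condition 2: as $n\to\infty$, $K$ is fixed, and for $z=0,1$ and $1\le k\le K$: (i) $p_z$ has a positive limit; (ii) $d_k/n$ has a limit; (iii) $G_z(t_k)$ has a limit; (iv) there is at least one $k$ such that $d_k/n$, $G_1(t_k)$, $G_0(t_k)$ have positive limits and $\lim_{n\to\infty}h_k<1$. *)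

theory Defs
  imports "HOL-Probability.Probability"
begin

text \<open>Population of size n, units indexed by i < n. T0 :: nat => real gives T_i(0).
  The distinct values t_1 < ... < t_K are represented 0-indexed: t_k = tval n T0 k, k < K.\<close>

definition tvals :: "nat \<Rightarrow> (nat \<Rightarrow> real) \<Rightarrow> real list" where
  "tvals n T0 = sorted_list_of_set (T0 ` {..<n})"

definition Knum :: "nat \<Rightarrow> (nat \<Rightarrow> real) \<Rightarrow> nat" where
  "Knum n T0 = length (tvals n T0)"

definition tval :: "nat \<Rightarrow> (nat \<Rightarrow> real) \<Rightarrow> nat \<Rightarrow> real" where
  "tval n T0 k = tvals n T0 ! k"

definition dcount :: "nat \<Rightarrow> (nat \<Rightarrow> real) \<Rightarrow> nat \<Rightarrow> real" where
  "dcount n T0 k = real (card {i\<in>{..<n}. T0 i = tval n T0 k})"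

definition ncount :: "nat \<Rightarrow> (nat \<Rightarrow> real) \<Rightarrow> nat \<Rightarrow> real" where
  "ncount n T0 k = real (card {i\<in>{..<n}. T0 i \<ge> tval n T0 k})"

definition hrate :: "nat \<Rightarrow> (nat \<Rightarrow> real) \<Rightarrow> nat \<Rightarrow> real" where
  "hrate n T0 k = dcount n T0 k / ncount n T0 k"

text \<open>z i = Z_i, c1 i = C_i(1), c0 i = C_i(0) (censoring times in [0,\<infinity>], as ereal).\<close>

definition Tobs :: "(nat \<Rightarrow> real) \<Rightarrow> (nat \<Rightarrow> real) \<Rightarrow> (nat \<Rightarrow> bool) \<Rightarrow> nat \<Rightarrow> real" where
  "Tobs T1 T0 z i = (if z i then T1 i else T0 i)"

definition Cobs :: "(nat \<Rightarrow> bool) \<Rightarrow> (nat \<Rightarrow> ereal) \<Rightarrow> (nat \<Rightarrow> ereal) \<Rightarrow> nat \<Rightarrow> ereal" where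
  "Cobs z c1 c0 i = (if z i then c1 i else c0 i)"

definition Wobs :: "(nat \<Rightarrow> real) \<Rightarrow> (nat \<Rightarrow> real) \<Rightarrow> (nat \<Rightarrow> bool)
    \<Rightarrow> (nat \<Rightarrow> ereal) \<Rightarrow> (nat \<Rightarrow> ereal) \<Rightarrow> nat \<Rightarrow> ereal" where
  "Wobs T1 T0 z c1 c0 i = min (ereal (Tobs T1 T0 z i)) (Cobs z c1 c0 i)"

definition Dobs :: "(nat \<Rightarrow> real) \<Rightarrow> (nat \<Rightarrow> real) \<Rightarrow> (nat \<Rightarrow> bool)
    \<Rightarrow> (nat \<Rightarrow> ereal) \<Rightarrow> (nat \<Rightarrow> ereal) \<Rightarrow> nat \<Rightarrow> bool" where
  "Dobs T1 T0 z c1 c0 i = (ereal (Tobs T1 T0 z i) \<le> Cobs z c1 c0 i)"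

definition N1k :: "nat \<Rightarrow> (nat \<Rightarrow> real) \<Rightarrow> (nat \<Rightarrow> real) \<Rightarrow> (nat \<Rightarrow> bool)
    \<Rightarrow> (nat \<Rightarrow> ereal) \<Rightarrow> (nat \<Rightarrow> ereal) \<Rightarrow> nat \<Rightarrow> real" where
  "N1k n T1 T0 z c1 c0 k =
     real (card {i\<in>{..<n}. z i \<and> Wobs T1 T0 z c1 c0 i \<ge> ereal (tval n T0 k)})"

definition N0k :: "nat \<Rightarrow> (nat \<Rightarrow> real) \<Rightarrow> (nat \<Rightarrow> real) \<Rightarrow> (nat \<Rightarrow> bool)
    \<Rightarrow> (nat \<Rightarrow> ereal) \<Rightarrow> (nat \<Rightarrow> ereal) \<Rightarrow> nat \<Rightarrow> real" where
  "N0k n T1 T0 z c1 c0 k =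
     real (card {i\<in>{..<n}. \<not> z i \<and> Wobs T1 T0 z c1 c0 i \<ge> ereal (tval n T0 k)})"

definition Nk :: "nat \<Rightarrow> (nat \<Rightarrow> real) \<Rightarrow> (nat \<Rightarrow> real) \<Rightarrow> (nat \<Rightarrow> bool)
    \<Rightarrow> (nat \<Rightarrow> ereal) \<Rightarrow> (nat \<Rightarrow> ereal) \<Rightarrow> nat \<Rightarrow> real" where
  "Nk n T1 T0 z c1 c0 k = N1k n T1 T0 z c1 c0 k + N0k n T1 T0 z c1 c0 k"

definition D1k :: "nat \<Rightarrow> (nat \<Rightarrow> real) \<Rightarrow> (nat \<Rightarrow> real) \<Rightarrow> (nat \<Rightarrow> bool)
    \<Rightarrow> (nat \<Rightarrow> ereal) \<Rightarrow> (nat \<Rightarrow> ereal) \<Rightarrow> nat \<Rightarrow> real" where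
  "D1k n T1 T0 z c1 c0 k =
     real (card {i\<in>{..<n}. z i \<and> Dobs T1 T0 z c1 c0 i \<and>
                             Wobs T1 T0 z c1 c0 i = ereal (tval n T0 k)})"

definition Dk :: "nat \<Rightarrow> (nat \<Rightarrow> real) \<Rightarrow> (nat \<Rightarrow> real) \<Rightarrow> (nat \<Rightarrow> bool)
    \<Rightarrow> (nat \<Rightarrow> ereal) \<Rightarrow> (nat \<Rightarrow> ereal) \<Rightarrow> nat \<Rightarrow> real" where
  "Dk n T1 T0 z c1 c0 k =
     real (card {i\<in>{..<n}. Dobs T1 T0 z c1 c0 i \<and>
                             Wobs T1 T0 z c1 c0 i = ereal (tval n T0 k)})"

text \<open>Division by zero yields 0 in Isabelle, matching the convention 0/0 := 0
  (the numerators vanish whenever the denominators do).\<close>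

definition Mk :: "nat \<Rightarrow> (nat \<Rightarrow> real) \<Rightarrow> (nat \<Rightarrow> real) \<Rightarrow> (nat \<Rightarrow> bool)
    \<Rightarrow> (nat \<Rightarrow> ereal) \<Rightarrow> (nat \<Rightarrow> ereal) \<Rightarrow> nat \<Rightarrow> real" where
  "Mk n T1 T0 z c1 c0 k =
     Dk n T1 T0 z c1 c0 k * N1k n T1 T0 z c1 c0 k / Nk n T1 T0 z c1 c0 k"

definition Vk :: "nat \<Rightarrow> (nat \<Rightarrow> real) \<Rightarrow> (nat \<Rightarrow> real) \<Rightarrow> (nat \<Rightarrow> bool)
    \<Rightarrow> (nat \<Rightarrow> ereal) \<Rightarrow> (nat \<Rightarrow> ereal) \<Rightarrow> nat \<Rightarrow> real" where
  "Vk n T1 T0 z c1 c0 k =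
     Dk n T1 T0 z c1 c0 k * (Nk n T1 T0 z c1 c0 k - Dk n T1 T0 z c1 c0 k)
       * N1k n T1 T0 z c1 c0 k * N0k n T1 T0 z c1 c0 k
     / ((Nk n T1 T0 z c1 c0 k)\<^sup>2 * (Nk n T1 T0 z c1 c0 k - 1))"

definition Lstat :: "nat \<Rightarrow> (nat \<Rightarrow> real) \<Rightarrow> (nat \<Rightarrow> real) \<Rightarrow> (nat \<Rightarrow> bool)
    \<Rightarrow> (nat \<Rightarrow> ereal) \<Rightarrow> (nat \<Rightarrow> ereal) \<Rightarrow> real" where
  "Lstat n T1 T0 z c1 c0 =
     (\<Sum>k<Knum n T0. D1k n T1 T0 z c1 c0 k - Mk n T1 T0 z c1 c0 k)"

definition Ustat :: "nat \<Rightarrow> (nat \<Rightarrow> real) \<Rightarrow> (nat \<Rightarrow> real) \<Rightarrow> (nat \<Rightarrow> bool)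
    \<Rightarrow> (nat \<Rightarrow> ereal) \<Rightarrow> (nat \<Rightarrow> ereal) \<Rightarrow> real" where
  "Ustat n T1 T0 z c1 c0 = (\<Sum>k<Knum n T0. Vk n T1 T0 z c1 c0 k)"

definition conv_in_prob_const :: "(nat \<Rightarrow> 'a measure) \<Rightarrow> (nat \<Rightarrow> 'a \<Rightarrow> real) \<Rightarrow> real \<Rightarrow> bool" where
  "conv_in_prob_const M X c \<longleftrightarrow>
     (\<forall>e>0. (\<lambda>n. measure (M n) {\<omega>\<in>space (M n). \<bar>X n \<omega> - c\<bar> > e}) \<longlonglongrightarrow> 0)"

end

theory Submission
  imports Defs
begin

text \<open>
  Let \<open>A\<close> and \<open>B\<close> indicate that a unit is treated, respectively untreated, and not censored before \<open>t k\<close>,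
  with means \<open>a\<close> and \<open>b\<close>, let \<open>h\<close> be the hazard at \<open>t k\<close> and \<open>p = a / (a + b)\<close>. Under the null
  hypothesis \<open>L = Lin + R\<close>, where \<open>Lin\<close> is the sum over units and event times of
  \<open>(1(T = t k) - h 1(T \<ge> t k)) (A - p (A + B))\<close> and \<open>R\<close> is the sum over event times of
  \<open>(h - D / N) (N1 - p N)\<close>. The units are independent and the cross terms of distinct event times
  cancel in the variance, so \<open>Lin\<close> has variance \<open>s2 = \<Sum>k. d (1 - h) a b / (a + b)\<close>, which is of order \<open>n\<close>.
  Second and fourth moment bounds for centred sums give \<open>E|U - s2| = O(\<surd>n)\<close> and \<open>E R\<^sup>2 = o(n)\<close>, both
  non-asymptotically and uniformly in the parameters. The central limit theorem for the bounded array
  \<open>Lin\<close> follows from characteristic functions, and the remainder is absorbed by a Slutsky argument.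
\<close>

lemma abs_one_minus_exp_le:
  fixes x :: real
  assumes "0 \<le> x"
  shows "\<bar>1 - x - exp (- x)\<bar> \<le> x\<^sup>2 / 2"
proof -
  have "exp (- x) \<le> 1 - x + x\<^sup>2 / 2"
  proof -
    have "((\<lambda>y. 1 - y + y\<^sup>2 / 2 - exp (- y)) has_real_derivative (- 1 + y + exp (- y))) (at y)" for y :: real
      by (auto intro!: derivative_eq_intros)
    moreover have "0 \<le> - 1 + y + exp (- y)" for y :: real
      using exp_ge_add_one_self[of "- y"] by simp
    ultimately have "1 - 0 + 0\<^sup>2 / 2 - exp (- 0) \<le> 1 - x + x\<^sup>2 / 2 - exp (- x)"
      using assms by (intro DERIV_nonneg_imp_nondecreasing[of 0 x "\<lambda>y. 1 - y + y\<^sup>2 / 2 - exp (- y)"]) auto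
    then show ?thesis by simp
  qed
  with exp_ge_add_one_self[of "- x"] show ?thesis by simp
qed

section \<open>Bounded random variables\<close>

context prob_space
begin

definition bdd_rv :: "('a \<Rightarrow> real) \<Rightarrow> bool" where
  "bdd_rv X \<longleftrightarrow> X \<in> borel_measurable M \<and> (\<exists>c. \<forall>\<omega>\<in>space M. \<bar>X \<omega>\<bar> \<le> c)"

lemma bdd_rvI:
  assumes "X \<in> borel_measurable M" "\<And>\<omega>. \<omega> \<in> space M \<Longrightarrow> \<bar>X \<omega>\<bar> \<le> c"
  shows "bdd_rv X"
  using assms unfolding bdd_rv_def by blast

lemma bdd_rv_measurable: "bdd_rv X \<Longrightarrow> X \<in> borel_measurable M"
  unfolding bdd_rv_def by blast

lemma bdd_rv_mono:
  assumes "X \<in> borel_measurable M" "bdd_rv Y" "\<And>\<omega>. \<omega> \<in> space M \<Longrightarrow> \<bar>X \<omega>\<bar> \<le> Y \<omega>"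
  shows "bdd_rv X"
proof -
  obtain c where "\<And>\<omega>. \<omega> \<in> space M \<Longrightarrow> \<bar>Y \<omega>\<bar> \<le> c"
    using assms(2) unfolding bdd_rv_def by blast
  then show ?thesis
    using assms(1,3) by (intro bdd_rvI[where c=c]) fastforce+
qed

lemma bdd_rv_integrable: "bdd_rv X \<Longrightarrow> integrable M X"
  unfolding bdd_rv_def by (metis AE_I2 integrable_const_bound real_norm_def)

lemma bdd_rv_const: "bdd_rv (\<lambda>_. c)"
  by (rule bdd_rvI[where c="\<bar>c\<bar>"]) auto

lemma bdd_rv_abs: "bdd_rv X \<Longrightarrow> bdd_rv (\<lambda>\<omega>. \<bar>X \<omega>\<bar>)"
  unfolding bdd_rv_def by auto

lemma bdd_rv_uminus: "bdd_rv X \<Longrightarrow> bdd_rv (\<lambda>\<omega>. - X \<omega>)"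
  unfolding bdd_rv_def by auto

lemma bdd_rv_add:
  assumes "bdd_rv X" "bdd_rv Y"
  shows "bdd_rv (\<lambda>\<omega>. X \<omega> + Y \<omega>)"
proof -
  obtain c d where "\<And>\<omega>. \<omega> \<in> space M \<Longrightarrow> \<bar>X \<omega>\<bar> \<le> c" "\<And>\<omega>. \<omega> \<in> space M \<Longrightarrow> \<bar>Y \<omega>\<bar> \<le> d"
    using assms unfolding bdd_rv_def by blast
  then show ?thesis
    using assms[THEN bdd_rv_measurable] by (intro bdd_rvI[where c="c+d"]) fastforce+
qed

lemma bdd_rv_diff:
  assumes "bdd_rv X" "bdd_rv Y"
  shows "bdd_rv (\<lambda>\<omega>. X \<omega> - Y \<omega>)"
  using bdd_rv_add[OF assms(1) bdd_rv_uminus[OF assms(2)]] by simp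

lemma bdd_rv_mult:
  assumes "bdd_rv X" "bdd_rv Y"
  shows "bdd_rv (\<lambda>\<omega>. X \<omega> * Y \<omega>)"
proof -
  obtain c d where "\<And>\<omega>. \<omega> \<in> space M \<Longrightarrow> \<bar>X \<omega>\<bar> \<le> c" "\<And>\<omega>. \<omega> \<in> space M \<Longrightarrow> \<bar>Y \<omega>\<bar> \<le> d"
    using assms unfolding bdd_rv_def by blast
  then have "\<bar>X \<omega> * Y \<omega>\<bar> \<le> c * d" if "\<omega> \<in> space M" for \<omega>
    unfolding abs_mult using that by (intro mult_mono) (auto intro: order_trans[OF abs_ge_zero])
  then show ?thesis
    using assms[THEN bdd_rv_measurable] by (intro bdd_rvI[where c="c*d"]) auto
qed

lemma bdd_rv_power: "bdd_rv X \<Longrightarrow> bdd_rv (\<lambda>\<omega>. X \<omega> ^ k)"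
  by (induction k) (auto intro: bdd_rv_const bdd_rv_mult)

lemma bdd_rv_divide_const: "bdd_rv X \<Longrightarrow> bdd_rv (\<lambda>\<omega>. X \<omega> / c)"
  using bdd_rv_mult[OF _ bdd_rv_const[of "inverse c"]] by (simp add: divide_inverse)

lemma bdd_rv_sum: "(\<And>i. i \<in> I \<Longrightarrow> bdd_rv (X i)) \<Longrightarrow> bdd_rv (\<lambda>\<omega>. \<Sum>i\<in>I. X i \<omega>)"
  by (induction I rule: infinite_finite_induct) (auto intro: bdd_rv_const bdd_rv_add)

lemmas bdd_rv_intros =
  bdd_rv_const bdd_rv_abs bdd_rv_uminus bdd_rv_add bdd_rv_diff bdd_rv_mult bdd_rv_power
  bdd_rv_divide_const bdd_rv_sum

lemma expectation_abs_le_sqrt: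
  assumes X: "bdd_rv X"
  shows "expectation (\<lambda>\<omega>. \<bar>X \<omega>\<bar>) \<le> sqrt (expectation (\<lambda>\<omega>. (X \<omega>)\<^sup>2))"
proof -
  have "0 \<le> variance (\<lambda>\<omega>. \<bar>X \<omega>\<bar>)"
    by (rule variance_positive)
  also have "\<dots> = expectation (\<lambda>\<omega>. (X \<omega>)\<^sup>2) - (expectation (\<lambda>\<omega>. \<bar>X \<omega>\<bar>))\<^sup>2"
    by (subst variance_eq) (auto intro!: bdd_rv_integrable bdd_rv_intros X)
  finally show ?thesis
    by (intro real_le_rsqrt) simp
qed

lemma variance_perturbation_le:
  assumes X: "bdd_rv X" and R: "bdd_rv R" and mean: "expectation X = 0" and "0 < \<delta>"
  shows "\<bar>variance (\<lambda>\<omega>. X \<omega> + R \<omega>) - expectation (\<lambda>\<omega>. (X \<omega>)\<^sup>2)\<bar>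
    \<le> \<delta> * expectation (\<lambda>\<omega>. (X \<omega>)\<^sup>2) + (1 + 1 / \<delta>) * expectation (\<lambda>\<omega>. (R \<omega>)\<^sup>2)"
proof -
  note I = bdd_rv_integrable bdd_rv_intros X R
  have "expectation (\<lambda>\<omega>. X \<omega> + R \<omega>) = expectation R"
    using mean by (subst Bochner_Integration.integral_add) (auto intro!: I)
  moreover have "expectation (\<lambda>\<omega>. (X \<omega> + R \<omega>)\<^sup>2) = expectation (\<lambda>\<omega>. (X \<omega>)\<^sup>2)
      + expectation (\<lambda>\<omega>. 2 * X \<omega> * R \<omega>) + expectation (\<lambda>\<omega>. (R \<omega>)\<^sup>2)"
  proof -
    have "expectation (\<lambda>\<omega>. (X \<omega> + R \<omega>)\<^sup>2)
        = expectation (\<lambda>\<omega>. ((X \<omega>)\<^sup>2 + 2 * X \<omega> * R \<omega>) + (R \<omega>)\<^sup>2)"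
      by (intro Bochner_Integration.integral_cong refl) (simp add: power2_eq_square algebra_simps)
    then show ?thesis
      by (subst (asm) Bochner_Integration.integral_add, (auto intro!: I)[2],
          subst (asm) Bochner_Integration.integral_add) (auto intro!: I)
  qed
  ultimately have var: "variance (\<lambda>\<omega>. X \<omega> + R \<omega>) - expectation (\<lambda>\<omega>. (X \<omega>)\<^sup>2)
      = expectation (\<lambda>\<omega>. 2 * X \<omega> * R \<omega>) + (expectation (\<lambda>\<omega>. (R \<omega>)\<^sup>2) - (expectation R)\<^sup>2)"
    by (subst variance_eq) (auto intro!: I)
  have "\<bar>expectation (\<lambda>\<omega>. 2 * X \<omega> * R \<omega>)\<bar> \<le> expectation (\<lambda>\<omega>. \<bar>2 * X \<omega> * R \<omega>\<bar>)"
    by (rule integral_abs_bound)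
  also have "\<dots> \<le> expectation (\<lambda>\<omega>. \<delta> * (X \<omega>)\<^sup>2 + (R \<omega>)\<^sup>2 / \<delta>)"
  proof (intro integral_mono)
    fix \<omega>
    have "0 \<le> (\<delta> * \<bar>X \<omega>\<bar> - \<bar>R \<omega>\<bar>)\<^sup>2 / \<delta>"
      using \<open>0 < \<delta>\<close> by simp
    also have "\<dots> = \<delta> * (X \<omega>)\<^sup>2 + (R \<omega>)\<^sup>2 / \<delta> - \<bar>2 * X \<omega> * R \<omega>\<bar>"
      using \<open>0 < \<delta>\<close> by (simp add: field_simps power2_diff abs_mult power_mult_distrib power2_eq_square)
    finally show "\<bar>2 * X \<omega> * R \<omega>\<bar> \<le> \<delta> * (X \<omega>)\<^sup>2 + (R \<omega>)\<^sup>2 / \<delta>"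
      by simp
  qed (auto intro!: I)
  also have "\<dots> = \<delta> * expectation (\<lambda>\<omega>. (X \<omega>)\<^sup>2) + expectation (\<lambda>\<omega>. (R \<omega>)\<^sup>2) / \<delta>"
    by (subst Bochner_Integration.integral_add) (auto intro!: I)
  finally have cross: "\<bar>expectation (\<lambda>\<omega>. 2 * X \<omega> * R \<omega>)\<bar>
    \<le> \<delta> * expectation (\<lambda>\<omega>. (X \<omega>)\<^sup>2) + expectation (\<lambda>\<omega>. (R \<omega>)\<^sup>2) / \<delta>" .
  have "0 \<le> variance R"
    by (rule variance_positive)
  also have "\<dots> = expectation (\<lambda>\<omega>. (R \<omega>)\<^sup>2) - (expectation R)\<^sup>2"
    by (subst variance_eq) (auto intro!: I)
  finally have "\<bar>expectation (\<lambda>\<omega>. (R \<omega>)\<^sup>2) - (expectation R)\<^sup>2\<bar> \<le> expectation (\<lambda>\<omega>. (R \<omega>)\<^sup>2)"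
    by simp
  with cross show ?thesis
    unfolding var by (simp add: algebra_simps)
qed

section \<open>Sums of independent centred bounded variables\<close>

lemma indep_vars_rv: "indep_vars (\<lambda>_. N) X I \<Longrightarrow> i \<in> I \<Longrightarrow> X i \<in> measurable M N"
  unfolding indep_vars_def by blast

lemma expectation_indep_sum_power2:
  assumes "finite I" "indep_vars (\<lambda>_. borel) X I"
    and "\<And>i. i \<in> I \<Longrightarrow> bdd_rv (X i)" and "\<And>i. i \<in> I \<Longrightarrow> expectation (X i) = 0"
  shows "expectation (\<lambda>\<omega>. (\<Sum>i\<in>I. X i \<omega>)\<^sup>2) = (\<Sum>i\<in>I. expectation (\<lambda>\<omega>. (X i \<omega>)\<^sup>2))"
  using assms
proof (induction I rule: finite_induct)
  case empty
  then show ?case by simp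
next
  case (insert i I)
  define S where "S \<omega> = (\<Sum>j\<in>I. X j \<omega>)" for \<omega>
  have ind: "indep_var borel (X i) borel S"
    using indep_vars_sum[OF insert(1,2,4)] by (simp add: S_def[abs_def])
  have b: "bdd_rv (X i)" "bdd_rv S"
    unfolding S_def[abs_def] using insert.prems by (auto intro!: bdd_rv_intros)
  note I = bdd_rv_integrable bdd_rv_intros b
  have "expectation (\<lambda>\<omega>. X i \<omega> * S \<omega>) = 0"
    using insert.prems by (subst indep_var_lebesgue_integral[OF ind]) (auto intro!: I)
  moreover have "expectation (\<lambda>\<omega>. (X i \<omega> + S \<omega>)\<^sup>2)
      = expectation (\<lambda>\<omega>. ((X i \<omega>)\<^sup>2 + 2 * (X i \<omega> * S \<omega>)) + (S \<omega>)\<^sup>2)"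
    by (intro Bochner_Integration.integral_cong refl) (simp add: power2_eq_square algebra_simps)
  moreover have "\<dots> = expectation (\<lambda>\<omega>. (X i \<omega>)\<^sup>2) + 2 * expectation (\<lambda>\<omega>. X i \<omega> * S \<omega>)
      + expectation (\<lambda>\<omega>. (S \<omega>)\<^sup>2)"
    by (subst Bochner_Integration.integral_add, (auto intro!: I)[2],
        subst Bochner_Integration.integral_add) (auto intro!: I)
  moreover have "expectation (\<lambda>\<omega>. (S \<omega>)\<^sup>2) = (\<Sum>i\<in>I. expectation (\<lambda>\<omega>. (X i \<omega>)\<^sup>2))"
    unfolding S_def using insert.prems
    by (intro insert.IH) (auto intro: indep_vars_subset)
  ultimately show ?case
    using insert.hyps by (simp add: S_def)
qed

lemma expectation_indep_sum_power4_le: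
  assumes "finite I" "indep_vars (\<lambda>_. borel) X I"
    and "\<And>i \<omega>. i \<in> I \<Longrightarrow> \<omega> \<in> space M \<Longrightarrow> \<bar>X i \<omega>\<bar> \<le> 1" and "\<And>i. i \<in> I \<Longrightarrow> expectation (X i) = 0"
  shows "expectation (\<lambda>\<omega>. (\<Sum>i\<in>I. X i \<omega>) ^ 4) \<le> 3 * (real (card I))\<^sup>2"
  using assms
proof (induction I rule: finite_induct)
  case empty
  then show ?case by simp
next
  case (insert i I)
  have bX: "bdd_rv (X j)" if "j \<in> insert i I" for j
    using that insert.prems(2) indep_vars_rv[OF insert.prems(1)] by (intro bdd_rvI[where c=1]) auto
  define S where "S \<omega> = (\<Sum>j\<in>I. X j \<omega>)" for \<omega>
  have ind: "indep_var borel (X i) borel S"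
    using indep_vars_sum[OF insert(1,2,4)] by (simp add: S_def[abs_def])
  have b: "bdd_rv (X i)" "bdd_rv S"
    unfolding S_def[abs_def] using bX by (auto intro!: bdd_rv_intros)
  note I = bdd_rv_integrable bdd_rv_intros b
  have prod: "expectation (\<lambda>\<omega>. X i \<omega> ^ j * S \<omega> ^ l)
      = expectation (\<lambda>\<omega>. X i \<omega> ^ j) * expectation (\<lambda>\<omega>. S \<omega> ^ l)" for j l
    using indep_var_compose[OF ind, of "\<lambda>x. x ^ j" borel "\<lambda>x. x ^ l" borel]
    by (intro indep_var_lebesgue_integral) (auto simp: o_def intro!: I)
  have ES: "expectation S = 0"
    unfolding S_def using insert.prems bX
    by (subst Bochner_Integration.integral_sum) (auto intro!: bdd_rv_integrable)
  have mom: "expectation (\<lambda>\<omega>. X i \<omega> ^ j) \<le> 1" if "even j" for j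
  proof -
    have "X i \<omega> ^ j \<le> 1" if "\<omega> \<in> space M" for \<omega>
      using power_le_one[of "\<bar>X i \<omega>\<bar>" j] insert.prems(2)[OF _ that, of i] \<open>even j\<close>
      by (simp add: power_even_abs)
    then have "expectation (\<lambda>\<omega>. X i \<omega> ^ j) \<le> expectation (\<lambda>_. 1)"
      by (intro integral_mono) (auto intro!: I)
    then show ?thesis by (simp add: prob_space)
  qed
  have S2: "expectation (\<lambda>\<omega>. (S \<omega>)\<^sup>2) \<le> card I"
  proof -
    have "expectation (\<lambda>\<omega>. (S \<omega>)\<^sup>2) = (\<Sum>j\<in>I. expectation (\<lambda>\<omega>. (X j \<omega>)\<^sup>2))"
      unfolding S_def using insert bX
      by (intro expectation_indep_sum_power2) (auto intro: indep_vars_subset)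
    also have "\<dots> \<le> (\<Sum>j\<in>I. 1)"
    proof (intro sum_mono)
      fix j assume j: "j \<in> I"
      have "expectation (\<lambda>\<omega>. (X j \<omega>)\<^sup>2) \<le> expectation (\<lambda>_. 1)"
        using insert.prems(2) bX j
        by (intro integral_mono) (auto intro!: bdd_rv_integrable bdd_rv_intros simp: abs_square_le_1)
      then show "expectation (\<lambda>\<omega>. (X j \<omega>)\<^sup>2) \<le> 1" by (simp add: prob_space)
    qed
    finally show ?thesis by simp
  qed
  have S4: "expectation (\<lambda>\<omega>. S \<omega> ^ 4) \<le> 3 * (real (card I))\<^sup>2"
    unfolding S_def using insert.prems by (intro insert.IH) (auto intro: indep_vars_subset)
  have "expectation (\<lambda>\<omega>. (X i \<omega> + S \<omega>) ^ 4) = expectation (\<lambda>\<omega>. \<Sum>k\<le>4.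
      real (4 choose k) * (X i \<omega> ^ k * S \<omega> ^ (4 - k)))"
    by (subst binomial_ring) (simp add: mult.assoc)
  also have "\<dots> = (\<Sum>k\<le>4. real (4 choose k) *
      (expectation (\<lambda>\<omega>. X i \<omega> ^ k) * expectation (\<lambda>\<omega>. S \<omega> ^ (4 - k))))"
    by (subst Bochner_Integration.integral_sum) (auto intro!: I simp: prod)
  also have "\<dots> = expectation (\<lambda>\<omega>. S \<omega> ^ 4)
      + 6 * (expectation (\<lambda>\<omega>. (X i \<omega>)\<^sup>2) * expectation (\<lambda>\<omega>. (S \<omega>)\<^sup>2)) + expectation (\<lambda>\<omega>. X i \<omega> ^ 4)"
    using ES insert.prems(3)[of i] by (simp add: eval_nat_numeral prob_space)
  also have "\<dots> \<le> 3 * (real (card I))\<^sup>2 + 6 * (1 * real (card I)) + 1"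
  proof -
    have "expectation (\<lambda>\<omega>. (X i \<omega>)\<^sup>2) * expectation (\<lambda>\<omega>. (S \<omega>)\<^sup>2) \<le> 1 * real (card I)"
      using S2 mom[of 2] by (intro mult_mono) (auto intro!: integral_nonneg_AE)
    then show ?thesis
      using S4 mom[of 4] by (intro add_mono mult_left_mono) auto
  qed
  also have "\<dots> \<le> 3 * (real (card (insert i I)))\<^sup>2"
    using insert.hyps by (simp add: power2_eq_square algebra_simps)
  finally show ?case
    using insert.hyps by (simp add: S_def)
qed

lemma char_indep_sum_normal_bound:
  assumes fin: "finite I" and ind: "indep_vars (\<lambda>_. borel) X I"
    and bnd: "\<And>i \<omega>. i \<in> I \<Longrightarrow> \<omega> \<in> space M \<Longrightarrow> \<bar>X i \<omega>\<bar> \<le> c"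
    and mean: "\<And>i. i \<in> I \<Longrightarrow> expectation (X i) = 0"
    and s: "0 < s" "s\<^sup>2 = (\<Sum>i\<in>I. expectation (\<lambda>\<omega>. (X i \<omega>)\<^sup>2))" and "0 \<le> c"
  shows "cmod (char (distr M borel (\<lambda>\<omega>. (\<Sum>i\<in>I. X i \<omega>) / s)) t - exp (- (t\<^sup>2) / 2))
    \<le> \<bar>t\<bar> ^ 3 * c / (6 * s) + t ^ 4 * c\<^sup>2 / (8 * s\<^sup>2)"
proof -
  define Y where "Y i \<omega> = X i \<omega> / s" for i \<omega>
  define w where "w i = expectation (\<lambda>\<omega>. (X i \<omega>)\<^sup>2) / s\<^sup>2" for i
  have rv: "X i \<in> borel_measurable M" if "i \<in> I" for i
    using indep_vars_rv[OF ind that] .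
  have bX: "bdd_rv (X i)" if "i \<in> I" for i
    using bnd rv that by (intro bdd_rvI[where c=c]) auto
  note J = bdd_rv_integrable bdd_rv_intros bX
  have bY: "bdd_rv (Y i)" if "i \<in> I" for i
    unfolding Y_def[abs_def] using that by (intro J)
  have indY: "indep_vars (\<lambda>_. borel) Y I"
    unfolding Y_def[abs_def] by (rule indep_vars_compose2[OF ind]) auto
  have w: "(\<Sum>i\<in>I. w i) = 1"
    using s(1) by (simp add: w_def sum_divide_distrib[symmetric] s(2)[symmetric])
  have w0: "0 \<le> w i" for i
    by (auto simp: w_def intro!: divide_nonneg_nonneg integral_nonneg_AE)
  have EY2: "expectation (\<lambda>\<omega>. (Y i \<omega>)\<^sup>2) = w i" for i
    by (simp add: Y_def w_def power_divide)
  have wle: "w i \<le> c\<^sup>2 / s\<^sup>2" if "i \<in> I" for i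
  proof -
    have "expectation (\<lambda>\<omega>. (X i \<omega>)\<^sup>2) \<le> expectation (\<lambda>_. c\<^sup>2)"
      using bnd[OF that] that \<open>0 \<le> c\<close> by (intro integral_mono J) (auto simp: abs_le_square_iff[symmetric])
    then show ?thesis
      using s(1) by (simp add: w_def prob_space divide_right_mono)
  qed
  have step: "cmod (char (distr M borel (Y i)) t - exp (- (t\<^sup>2 * w i / 2)))
      \<le> w i * (\<bar>t\<bar> ^ 3 * c / (6 * s) + t ^ 4 * c\<^sup>2 / (8 * s\<^sup>2))" if i: "i \<in> I" for i
  proof -
    have m0: "expectation (Y i) = 0"
      using mean[OF i] by (simp add: Y_def[abs_def])
    have "cmod (char (distr M borel (Y i)) t - (1 - t\<^sup>2 * w i / 2))
        \<le> (t\<^sup>2 / 6) * expectation (\<lambda>x. min (6 * (Y i x)\<^sup>2) (\<bar>t\<bar> * \<bar>Y i x\<bar> ^ 3))"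
      using m0 bY[OF i] EY2 by (intro char_approx3') (auto intro!: J dest: bdd_rv_measurable)
    also have "\<dots> \<le> (t\<^sup>2 / 6) * expectation (\<lambda>x. \<bar>t\<bar> * (c / s) * (Y i x)\<^sup>2)"
    proof (intro mult_left_mono integral_mono)
      have m: "Y i \<in> borel_measurable M"
        using bY[OF i] by (rule bdd_rv_measurable)
      show "integrable M (\<lambda>x. min (6 * (Y i x)\<^sup>2) (\<bar>t\<bar> * \<bar>Y i x\<bar> ^ 3))"
        using m bdd_rv_mult[OF bdd_rv_const[of 6] bdd_rv_power[OF bY[OF i], of 2]]
        by (intro bdd_rv_integrable[OF bdd_rv_mono]) auto
      fix \<omega> assume "\<omega> \<in> space M"
      then have "\<bar>Y i \<omega>\<bar> \<le> c / s"
        using bnd[OF i] s by (simp add: Y_def divide_right_mono)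
      then have "\<bar>Y i \<omega>\<bar> * \<bar>Y i \<omega>\<bar>\<^sup>2 \<le> c / s * (Y i \<omega>)\<^sup>2"
        using mult_right_mono[of "\<bar>Y i \<omega>\<bar>" "c / s" "(Y i \<omega>)\<^sup>2"] by simp
      then have "\<bar>t\<bar> * \<bar>Y i \<omega>\<bar> ^ 3 \<le> \<bar>t\<bar> * (c / s * (Y i \<omega>)\<^sup>2)"
        by (intro mult_left_mono) (simp_all add: power3_eq_cube power2_eq_square)
      then show "min (6 * (Y i \<omega>)\<^sup>2) (\<bar>t\<bar> * \<bar>Y i \<omega>\<bar> ^ 3) \<le> \<bar>t\<bar> * (c / s) * (Y i \<omega>)\<^sup>2"
        by (simp add: mult.assoc)
    qed (auto intro!: J bY i)
    also have "\<dots> = w i * (\<bar>t\<bar> ^ 3 * c / (6 * s))"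
    proof -
      have "\<bar>t\<bar> ^ 3 = \<bar>t\<bar> * t\<^sup>2"
        by (simp add: power3_eq_cube power2_eq_square)
      then show ?thesis
        by (simp add: EY2)
    qed
    finally have 1: "cmod (char (distr M borel (Y i)) t - (1 - t\<^sup>2 * w i / 2)) \<le> w i * (\<bar>t\<bar> ^ 3 * c / (6 * s))" .
    define x where "x = t\<^sup>2 * w i / 2"
    have "\<bar>1 - x - exp (- x)\<bar> \<le> x\<^sup>2 / 2"
      using w0 by (intro abs_one_minus_exp_le) (simp add: x_def)
    also have "x\<^sup>2 / 2 = w i * (t ^ 4 * w i / 8)"
      by (simp add: x_def power2_eq_square eval_nat_numeral)
    also have "\<dots> \<le> w i * (t ^ 4 * (c\<^sup>2 / s\<^sup>2) / 8)"
      using w0 wle[OF i] by (intro mult_left_mono divide_right_mono) auto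
    finally have "\<bar>(1 - x) - exp (- x)\<bar> \<le> w i * (t ^ 4 * c\<^sup>2 / (8 * s\<^sup>2))"
      by simp
    then have "cmod (complex_of_real (1 - x) - complex_of_real (exp (- x))) \<le> w i * (t ^ 4 * c\<^sup>2 / (8 * s\<^sup>2))"
      by (simp only: of_real_diff[symmetric] norm_of_real)
    with 1 norm_triangle_ineq[of "char (distr M borel (Y i)) t - (1 - t\<^sup>2 * w i / 2)"
        "complex_of_real (1 - x) - complex_of_real (exp (- x))"]
    show ?thesis
      by (simp add: x_def distrib_left)
  qed
  have "char (distr M borel (\<lambda>\<omega>. (\<Sum>i\<in>I. X i \<omega>) / s)) t = (\<Prod>i\<in>I. char (distr M borel (Y i)) t)"
    using char_distr_sum[OF indY] by (simp add: Y_def sum_divide_distrib)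
  moreover have "complex_of_real (exp (- (t\<^sup>2) / 2)) = (\<Prod>i\<in>I. complex_of_real (exp (- (t\<^sup>2 * w i / 2))))"
  proof -
    have "- (t\<^sup>2) / 2 = (\<Sum>i\<in>I. - (t\<^sup>2 * w i / 2))"
      using w by (simp add: sum_negf sum_divide_distrib[symmetric] sum_distrib_left[symmetric])
    then show ?thesis
      using fin by (simp only: exp_sum of_real_prod)
  qed
  ultimately have "cmod (char (distr M borel (\<lambda>\<omega>. (\<Sum>i\<in>I. X i \<omega>) / s)) t - exp (- (t\<^sup>2) / 2))
      \<le> (\<Sum>i\<in>I. cmod (char (distr M borel (Y i)) t - complex_of_real (exp (- (t\<^sup>2 * w i / 2)))))"
    using w0 bdd_rv_measurable[OF bY]
    by (simp only:, intro norm_prod_diff real_distribution.cmod_char_le_1 real_distribution_distr)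
       (auto simp only: norm_of_real abs_exp_cancel exp_le_one_iff, simp)
  also have "\<dots> \<le> (\<Sum>i\<in>I. w i * (\<bar>t\<bar> ^ 3 * c / (6 * s) + t ^ 4 * c\<^sup>2 / (8 * s\<^sup>2)))"
    by (intro sum_mono step)
  also have "\<dots> = \<bar>t\<bar> ^ 3 * c / (6 * s) + t ^ 4 * c\<^sup>2 / (8 * s\<^sup>2)"
    using w by (simp add: sum_distrib_right[symmetric])
  finally show ?thesis .
qed

end

lemma cmod_iexp_diff_le: "cmod (iexp x - iexp y) \<le> \<bar>x - y\<bar>"
proof -
  have "iexp x - iexp y = iexp y * (iexp (x - y) - 1)"
    by (simp add: exp_add[symmetric] algebra_simps)
  then have "cmod (iexp x - iexp y) = cmod (iexp (x - y) - 1)"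
    by (simp add: norm_mult)
  also have "\<dots> \<le> \<bar>x - y\<bar>"
    using iexp_approx1[of "x - y" 0] by simp
  finally show ?thesis .
qed

lemma abs_powr_minus_half_minus_one_le:
  fixes u :: real
  assumes "\<bar>u - 1\<bar> \<le> e" "e \<le> 1 / 2"
  shows "\<bar>u powr (- 1 / 2) - 1\<bar> \<le> 2 * e" "\<bar>u powr (- 1 / 2)\<bar> \<le> 2"
proof -
  have u: "1 / 2 \<le> u"
    using assms by linarith
  have eq: "u powr (- 1 / 2) = 1 / sqrt u"
    using u powr_minus_divide[of u "1/2"] powr_half_sqrt[of u] by simp
  have half: "1 / 2 \<le> sqrt u"
    using u by (intro real_le_rsqrt) (simp add: power2_eq_square)
  have "\<bar>1 - sqrt u\<bar> * 1 \<le> \<bar>1 - sqrt u\<bar> * (1 + sqrt u)"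
    using half u by (intro mult_left_mono) auto
  also have "\<dots> = \<bar>(1 - sqrt u) * (1 + sqrt u)\<bar>"
    using half u by (simp add: abs_mult)
  also have "(1 - sqrt u) * (1 + sqrt u) = 1 - u"
    using u by (simp add: algebra_simps)
  finally have le: "\<bar>1 - sqrt u\<bar> \<le> e"
    using assms by simp
  have "\<bar>u powr (- 1 / 2) - 1\<bar> = \<bar>1 - sqrt u\<bar> / sqrt u"
  proof -
    have "1 / sqrt u - 1 = (1 - sqrt u) / sqrt u"
      using half u by (simp add: diff_divide_distrib)
    then show ?thesis
      unfolding eq using half by (simp only: abs_divide)
  qed
  also have "\<dots> \<le> e / (1 / 2)"
    using le half by (intro frac_le) auto
  finally show "\<bar>u powr (- 1 / 2) - 1\<bar> \<le> 2 * e" by simp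
  show "\<bar>u powr (- 1 / 2)\<bar> \<le> 2"
    unfolding eq using half u by (simp add: divide_le_eq)
qed

lemma cmod_iexp_studentized_diff_le:
  fixes U X R s e t :: real
  assumes "0 < s" "0 < e" "e \<le> 1 / 2"
  shows "cmod (iexp (t * (U powr (- 1 / 2) * (X + R))) - iexp (t * (X / s)))
    \<le> 2 / e * (\<bar>U - s\<^sup>2\<bar> / s\<^sup>2) + \<bar>t\<bar> * (2 * e * (\<bar>X\<bar> / s) + 2 * (\<bar>R\<bar> / s))"
proof -
  define u where "u = U / s\<^sup>2"
  have U: "U = u * s\<^sup>2"
    using assms by (simp add: u_def)
  have dev: "\<bar>U - s\<^sup>2\<bar> / s\<^sup>2 = \<bar>u - 1\<bar>"
    using assms by (simp add: U abs_divide[symmetric] diff_divide_distrib abs_if field_simps)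
  show ?thesis
  proof (cases "\<bar>u - 1\<bar> \<le> e")
    case True
    have "U powr (- 1 / 2) = u powr (- 1 / 2) * (s\<^sup>2) powr (- 1 / 2)"
      unfolding U by (rule powr_mult)
    also have "(s\<^sup>2) powr (- 1 / 2) = 1 / s"
      using assms powr_minus_divide[of "s\<^sup>2" "1/2"] powr_half_sqrt[of "s\<^sup>2"] by simp
    finally have "U powr (- 1 / 2) * (X + R) - X / s
        = (u powr (- 1 / 2) - 1) * (X / s) + u powr (- 1 / 2) * (R / s)"
      using assms by (simp add: field_simps)
    then have "\<bar>U powr (- 1 / 2) * (X + R) - X / s\<bar>
        \<le> \<bar>(u powr (- 1 / 2) - 1) * (X / s)\<bar> + \<bar>u powr (- 1 / 2) * (R / s)\<bar>"
      by (simp only: abs_triangle_ineq)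
    also have "\<dots> \<le> 2 * e * (\<bar>X\<bar> / s) + 2 * (\<bar>R\<bar> / s)"
      using abs_powr_minus_half_minus_one_le[OF True assms(3)] assms
      unfolding abs_mult abs_divide by (intro add_mono mult_mono) auto
    finally have "\<bar>t\<bar> * \<bar>U powr (- 1 / 2) * (X + R) - X / s\<bar>
        \<le> \<bar>t\<bar> * (2 * e * (\<bar>X\<bar> / s) + 2 * (\<bar>R\<bar> / s))"
      by (rule mult_left_mono) simp
    then have "cmod (iexp (t * (U powr (- 1 / 2) * (X + R))) - iexp (t * (X / s)))
      \<le> \<bar>t\<bar> * (2 * e * (\<bar>X\<bar> / s) + 2 * (\<bar>R\<bar> / s))"
      by (intro order_trans[OF cmod_iexp_diff_le]) (simp add: abs_mult[symmetric] right_diff_distrib)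
    moreover have "0 \<le> 2 / e * (\<bar>U - s\<^sup>2\<bar> / s\<^sup>2)"
      using assms by simp
    ultimately show ?thesis by linarith
  next
    case False
    have "cmod (iexp (t * (U powr (- 1 / 2) * (X + R))) - iexp (t * (X / s))) \<le> 1 + 1"
      by (rule order_trans[OF norm_triangle_ineq4]) simp
    also have "\<dots> \<le> 2 / e * (\<bar>U - s\<^sup>2\<bar> / s\<^sup>2)"
      using False assms unfolding dev by (simp add: field_simps)
    also have "\<dots> \<le> \<dots> + \<bar>t\<bar> * (2 * e * (\<bar>X\<bar> / s) + 2 * (\<bar>R\<bar> / s))"
      using assms by simp
    finally show ?thesis .
  qed
qed

lemma (in prob_space) char_studentized_diff_le:
  assumes bdd: "bdd_rv U" "bdd_rv X" "bdd_rv R"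
    and s: "0 < s" "expectation (\<lambda>\<omega>. (X \<omega>)\<^sup>2) = s\<^sup>2" and e: "0 < e" "e \<le> 1 / 2"
  shows "cmod (char (distr M borel (\<lambda>\<omega>. U \<omega> powr (- 1 / 2) * (X \<omega> + R \<omega>))) t
      - char (distr M borel (\<lambda>\<omega>. X \<omega> / s)) t)
    \<le> 2 / e * (expectation (\<lambda>\<omega>. \<bar>U \<omega> - s\<^sup>2\<bar>) / s\<^sup>2)
      + \<bar>t\<bar> * (2 * e + 2 * sqrt (expectation (\<lambda>\<omega>. (R \<omega>)\<^sup>2) / s\<^sup>2))"
proof -
  note [measurable] = bdd[THEN bdd_rv_measurable]
  note I = bdd_rv_integrable bdd_rv_intros bdd
  define F where "F \<omega> = U \<omega> powr (- 1 / 2) * (X \<omega> + R \<omega>)" for \<omega>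
  have [measurable]: "F \<in> borel_measurable M"
    unfolding F_def[abs_def] by measurable
  have int: "complex_integrable M (\<lambda>\<omega>. iexp (t * G \<omega>))" if "G \<in> borel_measurable M" for G
    using that by (intro integrable_iexp) auto
  have "cmod (char (distr M borel F) t - char (distr M borel (\<lambda>\<omega>. X \<omega> / s)) t)
      = cmod (expectation (\<lambda>\<omega>. iexp (t * F \<omega>) - iexp (t * (X \<omega> / s))))"
    unfolding char_def
    by (subst (1 2) integral_distr, (measurable)[4], subst Bochner_Integration.integral_diff)
       (auto simp del: of_real_divide of_real_mult times_divide_eq_right intro!: int)
  also have "\<dots> \<le> expectation (\<lambda>\<omega>. cmod (iexp (t * F \<omega>) - iexp (t * (X \<omega> / s))))"
    by (rule integral_norm_bound)
  also have "\<dots> \<le> expectation (\<lambda>\<omega>. 2 / e * (\<bar>U \<omega> - s\<^sup>2\<bar> / s\<^sup>2)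
      + \<bar>t\<bar> * (2 * e * (\<bar>X \<omega>\<bar> / s) + 2 * (\<bar>R \<omega>\<bar> / s)))"
  proof (rule integral_mono)
    show "integrable M (\<lambda>\<omega>. cmod (iexp (t * F \<omega>) - iexp (t * (X \<omega> / s))))"
      by (intro integrable_norm Bochner_Integration.integrable_diff int) auto
  qed (auto simp only: F_def intro!: I cmod_iexp_studentized_diff_le s e)
  also have "\<dots> = 2 / e * (expectation (\<lambda>\<omega>. \<bar>U \<omega> - s\<^sup>2\<bar>) / s\<^sup>2)
      + \<bar>t\<bar> * (2 * e * (expectation (\<lambda>\<omega>. \<bar>X \<omega>\<bar>) / s) + 2 * (expectation (\<lambda>\<omega>. \<bar>R \<omega>\<bar>) / s))"
  proof -
    have lin: "expectation (\<lambda>\<omega>. A \<omega> + \<bar>t\<bar> * (B \<omega> + C \<omega>))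
        = expectation A + \<bar>t\<bar> * (expectation B + expectation C)"
      if "bdd_rv A" "bdd_rv B" "bdd_rv C" for A B C
      using that[THEN bdd_rv_integrable] by simp
    show ?thesis
      by (subst lin) (auto intro!: bdd_rv_intros bdd)
  qed
  also have "\<dots> \<le> 2 / e * (expectation (\<lambda>\<omega>. \<bar>U \<omega> - s\<^sup>2\<bar>) / s\<^sup>2)
      + \<bar>t\<bar> * (2 * e * (s / s) + 2 * (sqrt (expectation (\<lambda>\<omega>. (R \<omega>)\<^sup>2)) / s))"
    using expectation_abs_le_sqrt[OF bdd(2)] expectation_abs_le_sqrt[OF bdd(3)] s e
    by (intro add_mono order_refl mult_left_mono divide_right_mono) auto
  finally show ?thesis
    using s by (simp add: F_def[abs_def] real_sqrt_divide)
qed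

section \<open>Linearization of the log-rank statistic\<close>

lemma logrank_variance_term_bound:
  fixes D N N1 N0 h p :: real
  assumes N: "N = N1 + N0" "0 \<le> N1" "0 \<le> N0" and D: "0 \<le> D" "D \<le> N"
    and int: "N = 0 \<or> N = 1 \<or> 2 \<le> N"
    and h: "0 \<le> h" "h \<le> 1" and p: "0 \<le> p" "p \<le> 1"
  shows "\<bar>D * (N - D) * N1 * N0 / (N\<^sup>2 * (N - 1)) - N * (h * (1 - h) * (p * (1 - p)))\<bar>
    \<le> \<bar>h * N - D\<bar> + \<bar>N1 - p * N\<bar> + 1"
proof -
  have quad: "0 \<le> x * (1 - x)" "x * (1 - x) \<le> 1 / 4" if "0 \<le> x" "x \<le> 1" for x :: real
  proof -
    show "0 \<le> x * (1 - x)" using that by simp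
    show "x * (1 - x) \<le> 1 / 4"
      using zero_le_power2[of "x - 1 / 2"] by (simp add: power2_eq_square algebra_simps)
  qed
  have lip: "\<bar>x * (1 - x) - y * (1 - y)\<bar> \<le> \<bar>x - y\<bar>" if "0 \<le> x" "x \<le> 1" "0 \<le> y" "y \<le> 1" for x y :: real
  proof -
    have "\<bar>x * (1 - x) - y * (1 - y)\<bar> = \<bar>x - y\<bar> * \<bar>1 - x - y\<bar>"
      unfolding abs_mult[symmetric] by (simp add: algebra_simps)
    also have "\<dots> \<le> \<bar>x - y\<bar> * 1"
      using that by (intro mult_left_mono) auto
    finally show ?thesis by simp
  qed
  have abs_sum: "\<bar>A * B + C * E\<bar> \<le> \<bar>A\<bar> * B + C * \<bar>E\<bar>" if "0 \<le> B" "0 \<le> C" for A B C E :: real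
    using abs_triangle_ineq[of "A * B" "C * E"] that by (simp add: abs_mult)
  have hp: "0 \<le> h * (1 - h) * (p * (1 - p))" "h * (1 - h) * (p * (1 - p)) \<le> 1"
    using mult_mono[OF quad(2)[OF h] quad(2)[OF p]] quad(1)[OF h] quad(1)[OF p] by auto
  consider "N = 0" | "N = 1" | "2 \<le> N"
    using int by blast
  then show ?thesis
  proof cases
    case 1
    then show ?thesis by simp
  next
    case 2
    then show ?thesis using hp by simp
  next
    case 3
    define x where "x = D / N"
    define y where "y = N1 / N"
    have x: "0 \<le> x" "x \<le> 1" and y: "0 \<le> y" "y \<le> 1"
      using 3 D N by (auto simp: x_def y_def)
    have eqs: "D = N * x" "N1 = N * y" "N0 = N * (1 - y)"
      using 3 N by (auto simp: x_def y_def field_simps)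
    define P where "P = x * (1 - x) * (y * (1 - y))"
    have P: "0 \<le> P" "P \<le> 1 / 4"
      using mult_mono[OF quad(2)[OF x] quad(2)[OF y]] quad(1)[OF x] quad(1)[OF y]
      by (auto simp: P_def)
    have "D * (N - D) * N1 * N0 = N\<^sup>2 * (N\<^sup>2 * P)"
      unfolding eqs P_def by (simp add: power2_eq_square algebra_simps)
    then have "D * (N - D) * N1 * N0 / (N\<^sup>2 * (N - 1)) = N\<^sup>2 * P / (N - 1)"
      using 3 by (simp only: mult_divide_mult_cancel_left_if) simp
    also have "\<dots> = N * P + N * P / (N - 1)"
      using 3 by (simp add: field_simps power2_eq_square)
    finally have V: "D * (N - D) * N1 * N0 / (N\<^sup>2 * (N - 1)) = N * P + N * P / (N - 1)" .
    have "N * P \<le> N * (1 / 4)"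
      using P 3 by (intro mult_left_mono) auto
    then have "N * P \<le> N - 1"
      using 3 by linarith
    then have "N * P / (N - 1) \<le> 1" "0 \<le> N * P / (N - 1)"
      using 3 P by (auto simp: field_simps)
    moreover have "\<bar>N * P - N * (h * (1 - h) * (p * (1 - p)))\<bar> \<le> \<bar>h * N - D\<bar> + \<bar>N1 - p * N\<bar>"
    proof -
      have "P - h * (1 - h) * (p * (1 - p))
          = (x * (1 - x) - h * (1 - h)) * (y * (1 - y)) + h * (1 - h) * (y * (1 - y) - p * (1 - p))"
        by (simp add: P_def algebra_simps)
      then have "\<bar>P - h * (1 - h) * (p * (1 - p))\<bar>
          \<le> \<bar>x * (1 - x) - h * (1 - h)\<bar> * (y * (1 - y)) + h * (1 - h) * \<bar>y * (1 - y) - p * (1 - p)\<bar>"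
        using quad(1)[OF y] quad(1)[OF h] by (simp only: abs_sum)
      also have "\<dots> \<le> \<bar>x - h\<bar> * 1 + 1 * \<bar>y - p\<bar>"
        using quad[OF y] quad[OF h] lip[OF x h] lip[OF y p] by (intro add_mono mult_mono) auto
      finally have "N * \<bar>P - h * (1 - h) * (p * (1 - p))\<bar> \<le> N * (\<bar>x - h\<bar> + \<bar>y - p\<bar>)"
        using 3 by (intro mult_left_mono) auto
      also have "\<dots> = \<bar>N * (x - h)\<bar> + \<bar>N * (y - p)\<bar>"
        using 3 by (simp add: abs_mult distrib_left)
      also have "\<dots> = \<bar>h * N - D\<bar> + \<bar>N1 - p * N\<bar>"
        unfolding eqs by (simp add: algebra_simps abs_minus_commute)
      finally show ?thesis
        using 3 by (simp add: abs_mult right_diff_distrib[symmetric])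
    qed
    ultimately show ?thesis
      unfolding V by linarith
  qed
qed

text \<open>Unit \<open>i\<close> has event time \<open>T i\<close> and an observation \<open>Y i\<close>; \<open>\<alpha> k (Y i)\<close> and \<open>\<beta> k (Y i)\<close> indicate that
  it is treated, respectively untreated, and not censored before \<open>t k\<close>.\<close>

locale logrank = prob_space M for M :: "'a measure" +
  fixes n K :: nat and T t :: "nat \<Rightarrow> real" and N :: "'b measure" and Y :: "nat \<Rightarrow> 'a \<Rightarrow> 'b"
    and \<alpha> \<beta> :: "nat \<Rightarrow> 'b \<Rightarrow> real" and a b :: "nat \<Rightarrow> real"
  assumes indep: "indep_vars (\<lambda>_. N) Y {..<n}"
    and \<alpha>_measurable [measurable]: "\<alpha> k \<in> borel_measurable N"
    and \<beta>_measurable [measurable]: "\<beta> k \<in> borel_measurable N"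
    and \<alpha>_01: "\<alpha> k y = 0 \<or> \<alpha> k y = 1"
    and \<beta>_01: "\<beta> k y = 0 \<or> \<beta> k y = 1"
    and disjoint: "\<alpha> k y * \<beta> l y = 0"
    and \<alpha>_antimono: "k \<le> l \<Longrightarrow> l < K \<Longrightarrow> \<alpha> k y * \<alpha> l y = \<alpha> l y"
    and \<beta>_antimono: "k \<le> l \<Longrightarrow> l < K \<Longrightarrow> \<beta> k y * \<beta> l y = \<beta> l y"
    and \<alpha>_mean: "i < n \<Longrightarrow> expectation (\<lambda>\<omega>. \<alpha> k (Y i \<omega>)) = a k"
    and \<beta>_mean: "i < n \<Longrightarrow> expectation (\<lambda>\<omega>. \<beta> k (Y i \<omega>)) = b k"
    and ab_bounds: "0 \<le> a k" "0 \<le> b k" "a k + b k \<le> 1"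
    and t_mono: "k < l \<Longrightarrow> l < K \<Longrightarrow> t k < t l"
begin

definition ev :: "nat \<Rightarrow> nat \<Rightarrow> real" where "ev k i = of_bool (T i = t k)"
definition risk :: "nat \<Rightarrow> nat \<Rightarrow> real" where "risk k i = of_bool (t k \<le> T i)"
definition d :: "nat \<Rightarrow> real" where "d k = (\<Sum>i<n. ev k i)"
definition m :: "nat \<Rightarrow> real" where "m k = (\<Sum>i<n. risk k i)"
definition h :: "nat \<Rightarrow> real" where "h k = d k / m k"
definition q :: "nat \<Rightarrow> real" where "q k = a k + b k"
definition p :: "nat \<Rightarrow> real" where "p k = a k / q k"
definition v :: "nat \<Rightarrow> real" where "v k = a k * b k / q k"
definition e :: "nat \<Rightarrow> nat \<Rightarrow> real" where "e k i = ev k i - h k * risk k i"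
definition \<gamma> :: "nat \<Rightarrow> 'b \<Rightarrow> real" where "\<gamma> k y = \<alpha> k y + \<beta> k y"
definition \<xi> :: "nat \<Rightarrow> 'b \<Rightarrow> real" where "\<xi> k y = \<alpha> k y - p k * \<gamma> k y"

definition N1 :: "nat \<Rightarrow> 'a \<Rightarrow> real" where "N1 k \<omega> = (\<Sum>i<n. risk k i * \<alpha> k (Y i \<omega>))"
definition N0 :: "nat \<Rightarrow> 'a \<Rightarrow> real" where "N0 k \<omega> = (\<Sum>i<n. risk k i * \<beta> k (Y i \<omega>))"
definition NN :: "nat \<Rightarrow> 'a \<Rightarrow> real" where "NN k \<omega> = N1 k \<omega> + N0 k \<omega>"
definition D1 :: "nat \<Rightarrow> 'a \<Rightarrow> real" where "D1 k \<omega> = (\<Sum>i<n. ev k i * \<alpha> k (Y i \<omega>))"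
definition D :: "nat \<Rightarrow> 'a \<Rightarrow> real" where "D k \<omega> = (\<Sum>i<n. ev k i * \<gamma> k (Y i \<omega>))"
definition V :: "nat \<Rightarrow> 'a \<Rightarrow> real" where
  "V k \<omega> = D k \<omega> * (NN k \<omega> - D k \<omega>) * N1 k \<omega> * N0 k \<omega> / ((NN k \<omega>)\<^sup>2 * (NN k \<omega> - 1))"
definition L :: "'a \<Rightarrow> real" where "L \<omega> = (\<Sum>k<K. D1 k \<omega> - D k \<omega> * N1 k \<omega> / NN k \<omega>)"
definition U :: "'a \<Rightarrow> real" where "U \<omega> = (\<Sum>k<K. V k \<omega>)"

definition lin :: "nat \<Rightarrow> 'a \<Rightarrow> real" where "lin i \<omega> = (\<Sum>k<K. e k i * \<xi> k (Y i \<omega>))"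
definition Lin :: "'a \<Rightarrow> real" where "Lin \<omega> = (\<Sum>i<n. lin i \<omega>)"
definition S :: "nat \<Rightarrow> 'a \<Rightarrow> real" where "S k \<omega> = N1 k \<omega> - p k * NN k \<omega>"
definition Rk :: "nat \<Rightarrow> 'a \<Rightarrow> real" where "Rk k \<omega> = (h k - D k \<omega> / NN k \<omega>) * S k \<omega>"
definition R :: "'a \<Rightarrow> real" where "R \<omega> = (\<Sum>k<K. Rk k \<omega>)"
definition s2 :: real where "s2 = (\<Sum>k<K. d k * (1 - h k) * v k)"

lemma \<gamma>_01: "\<gamma> k y = 0 \<or> \<gamma> k y = 1"
  using \<alpha>_01[of k y] \<beta>_01[of k y] disjoint[of k y k] by (auto simp: \<gamma>_def)

lemma d_nonneg: "0 \<le> d k" and d_le_m: "d k \<le> m k"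
  unfolding d_def m_def by (intro sum_nonneg sum_mono; simp add: ev_def risk_def)+

lemma m_nonneg: "0 \<le> m k"
  using d_nonneg[of k] d_le_m[of k] by linarith

lemma m_le: "m k \<le> n"
proof -
  have "m k \<le> (\<Sum>i<n. 1)" unfolding m_def by (intro sum_mono) (auto simp: risk_def)
  then show ?thesis by simp
qed

lemma h_m: "h k * m k = d k"
  using d_nonneg[of k] d_le_m[of k] by (auto simp: h_def)

lemma h_bounds: "0 \<le> h k" "h k \<le> 1"
  using d_nonneg[of k] d_le_m[of k] m_nonneg[of k] by (auto simp: h_def divide_le_eq)

lemma q_bounds: "0 \<le> q k" "q k \<le> 1"
  using ab_bounds[of k] by (auto simp: q_def)

lemma p_q: "p k * q k = a k"
  using ab_bounds[of k] by (auto simp: p_def q_def)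

lemma p_bounds: "0 \<le> p k" "p k \<le> 1"
  using ab_bounds[of k] by (auto simp: p_def q_def divide_le_eq)

lemma v_eq: "v k = q k * (p k * (1 - p k))"
proof (cases "q k = 0")
  case False
  have "b k = q k * (1 - p k)"
    using p_q[of k] by (simp add: q_def algebra_simps)
  then show ?thesis
    using False by (simp add: v_def p_q[of k, symmetric])
qed (simp add: v_def)

lemma v_nonneg: "0 \<le> v k"
  using ab_bounds[of k] by (simp add: v_def q_def)

lemma sum_e: "(\<Sum>i<n. e k i) = 0"
  using h_m[of k] by (simp add: e_def sum_subtractf sum_distrib_left[symmetric] d_def[symmetric] m_def[symmetric])

lemma abs_e_le: "\<bar>e k i\<bar> \<le> 1"
  using h_bounds[of k] by (auto simp: e_def ev_def risk_def)

lemma sum_e_e: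
  assumes "k < K" "l < K"
  shows "(\<Sum>i<n. e k i * e l i) = (if k = l then d k * (1 - h k) else 0)"
proof -
  have less: "(\<Sum>i<n. e k i * e l i) = 0" if "k < l" "l < K" for k l
  proof -
    have "e k i * e l i = - h k * e l i" for i
      using t_mono[OF that] by (auto simp: e_def ev_def risk_def)
    then show ?thesis
      using sum_e[of l] by (simp only: sum_distrib_left[symmetric])
  qed
  have "(\<Sum>i<n. e k i * e k i) = (\<Sum>i<n. (1 - 2 * h k) * ev k i + (h k)\<^sup>2 * risk k i)"
    by (intro sum.cong refl) (auto simp: e_def ev_def risk_def power2_eq_square algebra_simps)
  also have "\<dots> = (1 - 2 * h k) * d k + h k * (h k * m k)"
    by (simp add: sum.distrib sum_distrib_left[symmetric] d_def m_def power2_eq_square)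
  also have "\<dots> = d k * (1 - h k)"
    unfolding h_m by (simp add: algebra_simps)
  finally have "(\<Sum>i<n. e k i * e k i) = d k * (1 - h k)" .
  with less[of k l] less[of l k] assms show ?thesis
    by (cases k l rule: linorder_cases) (auto simp: mult.commute)
qed

lemma \<gamma>_measurable [measurable]: "\<gamma> k \<in> borel_measurable N"
  unfolding \<gamma>_def[abs_def] by measurable

lemma \<xi>_measurable [measurable]: "\<xi> k \<in> borel_measurable N"
  unfolding \<xi>_def[abs_def] by measurable

lemma Y_measurable: "i < n \<Longrightarrow> Y i \<in> measurable M N"
  using indep_vars_rv[OF indep] by simp

lemma bdd_rv_compose:
  assumes "i < n" "g \<in> borel_measurable N" "\<And>y. \<bar>g y\<bar> \<le> c"
  shows "bdd_rv (\<lambda>\<omega>. g (Y i \<omega>))"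
  using assms Y_measurable by (intro bdd_rvI[where c=c]) (auto intro: measurable_compose)

lemma abs_\<gamma>: "\<bar>\<gamma> k y\<bar> \<le> 1" and abs_\<alpha>: "\<bar>\<alpha> k y\<bar> \<le> 1" and abs_\<beta>: "\<bar>\<beta> k y\<bar> \<le> 1"
  using \<gamma>_01[of k y] \<alpha>_01[of k y] \<beta>_01[of k y] by auto

lemma \<xi>_cases: "\<xi> k y = 0 \<or> \<xi> k y = - p k \<and> \<gamma> k y = 1 \<or> \<xi> k y = 1 - p k \<and> \<gamma> k y = 1"
  using \<alpha>_01[of k y] \<gamma>_01[of k y] \<beta>_01[of k y] by (auto simp: \<xi>_def \<gamma>_def)

lemma abs_\<xi>: "\<bar>\<xi> k y\<bar> \<le> 1"
  using \<xi>_cases[of k y] p_bounds[of k] by auto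

lemma \<xi>_square_le: "(\<xi> k y)\<^sup>2 \<le> \<gamma> k y"
proof -
  have "(1 - p k)\<^sup>2 \<le> 1" "(p k)\<^sup>2 \<le> 1"
    using p_bounds[of k] by (auto intro!: power_le_one)
  then show ?thesis
    using \<xi>_cases[of k y] \<gamma>_01[of k y] by auto
qed

lemmas bdd_unit =
  bdd_rv_compose[OF _ \<alpha>_measurable abs_\<alpha>] bdd_rv_compose[OF _ \<beta>_measurable abs_\<beta>]
  bdd_rv_compose[OF _ \<gamma>_measurable abs_\<gamma>] bdd_rv_compose[OF _ \<xi>_measurable abs_\<xi>]

lemma \<gamma>_mean: "i < n \<Longrightarrow> expectation (\<lambda>\<omega>. \<gamma> k (Y i \<omega>)) = q k"
  by (simp add: \<gamma>_def q_def \<alpha>_mean \<beta>_mean bdd_unit bdd_rv_integrable)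

lemma \<xi>_mean: "i < n \<Longrightarrow> expectation (\<lambda>\<omega>. \<xi> k (Y i \<omega>)) = 0"
  by (simp add: \<xi>_def \<gamma>_mean \<alpha>_mean bdd_unit bdd_rv_integrable p_q)

text \<open>The covariance of the scores at two event times is governed by the later one alone; as the
  weights \<open>e\<close> at that time sum to zero, the cross terms cancel in the variance of \<open>Lin\<close>.\<close>

lemma \<xi>_cov:
  assumes "i < n" "k \<le> l" "l < K"
  shows "expectation (\<lambda>\<omega>. \<xi> k (Y i \<omega>) * \<xi> l (Y i \<omega>)) = v l"
proof -
  have "\<xi> k y * \<xi> l y = (1 - p k) * (1 - p l) * \<alpha> l y + p k * p l * \<beta> l y" for y
  proof -
    have "\<xi> k y * \<xi> l y = (1 - p k) * (1 - p l) * (\<alpha> k y * \<alpha> l y) + p k * p l * (\<beta> k y * \<beta> l y)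
        - (1 - p k) * p l * (\<alpha> k y * \<beta> l y) - p k * (1 - p l) * (\<alpha> l y * \<beta> k y)"
      unfolding \<xi>_def \<gamma>_def by (simp add: algebra_simps)
    then show ?thesis
      by (simp only: disjoint \<alpha>_antimono[OF assms(2,3)] \<beta>_antimono[OF assms(2,3)])
  qed
  then have "expectation (\<lambda>\<omega>. \<xi> k (Y i \<omega>) * \<xi> l (Y i \<omega>)) = (1 - p k) * (1 - p l) * a l + p k * p l * b l"
    using assms by (simp add: \<alpha>_mean \<beta>_mean bdd_unit bdd_rv_integrable)
  also have "\<dots> = v l"
  proof -
    have b: "b l = (1 - p l) * q l"
      using p_q[of l] by (simp add: q_def algebra_simps)
    show ?thesis
      unfolding v_eq b p_q[of l, symmetric] by (simp add: algebra_simps)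
  qed
  finally show ?thesis .
qed

lemma bdd_counts: "bdd_rv (N1 k)" "bdd_rv (N0 k)" "bdd_rv (NN k)" "bdd_rv (D1 k)" "bdd_rv (D k)" "bdd_rv (S k)"
  unfolding S_def[abs_def] NN_def[abs_def] N1_def[abs_def] N0_def[abs_def] D1_def[abs_def] D_def[abs_def]
  by (auto intro!: bdd_rv_intros bdd_unit)

lemma count_bounds: "0 \<le> N1 k \<omega>" "0 \<le> N0 k \<omega>" "0 \<le> D k \<omega>" "D k \<omega> \<le> NN k \<omega>"
proof -
  show "0 \<le> N1 k \<omega>" "0 \<le> N0 k \<omega>" "0 \<le> D k \<omega>"
    using \<alpha>_01 \<beta>_01 \<gamma>_01 unfolding N1_def N0_def D_def
    by (auto intro!: sum_nonneg mult_nonneg_nonneg simp: risk_def ev_def)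
       (metis order_refl zero_le_one)+
  have "ev k i * \<gamma> k y \<le> risk k i * \<gamma> k y" for i y
    using \<gamma>_01[of k y] by (auto simp: ev_def risk_def)
  then show "D k \<omega> \<le> NN k \<omega>"
    unfolding NN_def N1_def N0_def D_def sum.distrib[symmetric] distrib_left[symmetric] \<gamma>_def[symmetric]
    by (intro sum_mono) auto
qed

lemma NN_eq: "NN k \<omega> = (\<Sum>i<n. risk k i * \<gamma> k (Y i \<omega>))"
  by (simp add: NN_def N1_def N0_def \<gamma>_def sum.distrib distrib_left)

lemma NN_cases: "NN k \<omega> = 0 \<or> NN k \<omega> = 1 \<or> 2 \<le> NN k \<omega>"
proof -
  have "NN k \<omega> = real (\<Sum>i<n. of_bool (t k \<le> T i \<and> \<gamma> k (Y i \<omega>) = 1))"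
    unfolding NN_eq of_nat_sum using \<gamma>_01 by (intro sum.cong refl) (auto simp: risk_def)
  then obtain j :: nat where "NN k \<omega> = real j" by blast
  then show ?thesis by (cases "j \<ge> 2") (auto simp: not_le numeral_2_eq_2 less_Suc_eq)
qed

lemma L_eq: "L \<omega> = Lin \<omega> + R \<omega>"
proof -
  have "D1 k \<omega> - D k \<omega> * N1 k \<omega> / NN k \<omega> = (\<Sum>i<n. e k i * \<xi> k (Y i \<omega>)) + Rk k \<omega>" for k
  proof -
    have "(\<Sum>i<n. e k i * \<xi> k (Y i \<omega>)) = (D1 k \<omega> - p k * D k \<omega>) - h k * S k \<omega>"
      unfolding D1_def D_def S_def NN_eq N1_def
      by (simp add: sum_distrib_left sum_subtractf[symmetric] e_def \<xi>_def algebra_simps)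
    moreover have "D k \<omega> / NN k \<omega> * NN k \<omega> = D k \<omega>"
      using count_bounds[of k \<omega>] by (cases "NN k \<omega> = 0") auto
    then have "p k * D k \<omega> = D k \<omega> / NN k \<omega> * (p k * NN k \<omega>)"
      by (simp add: mult.left_commute mult.assoc)
    ultimately show ?thesis
      by (simp add: Rk_def S_def left_diff_distrib right_diff_distrib)
  qed
  then show ?thesis
    unfolding L_def R_def Lin_def lin_def sum.distrib
    by (simp add: sum.distrib sum.swap[of _ "{..<n}" "{..<K}"])
qed

lemma weighted_sum_moments:
  assumes g: "g \<in> borel_measurable N" "\<And>y. \<bar>g y\<bar> \<le> 1" "\<And>i. i < n \<Longrightarrow> expectation (\<lambda>\<omega>. g (Y i \<omega>)) = 0"
    and w: "\<And>i. \<bar>w i\<bar> \<le> (1::real)"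
  shows "expectation (\<lambda>\<omega>. (\<Sum>i<n. w i * g (Y i \<omega>))\<^sup>2) = (\<Sum>i<n. (w i)\<^sup>2 * expectation (\<lambda>\<omega>. (g (Y i \<omega>))\<^sup>2))"
    and "expectation (\<lambda>\<omega>. (\<Sum>i<n. w i * g (Y i \<omega>))\<^sup>2) \<le> n"
    and "expectation (\<lambda>\<omega>. (\<Sum>i<n. w i * g (Y i \<omega>)) ^ 4) \<le> 3 * (real n)\<^sup>2"
proof -
  have ind: "indep_vars (\<lambda>_. borel) (\<lambda>i \<omega>. w i * g (Y i \<omega>)) {..<n}"
    using g(1) by (intro indep_vars_compose2[OF indep]) auto
  have bdd: "bdd_rv (\<lambda>\<omega>. g (Y i \<omega>))" if "i < n" for i
    using that g by (intro bdd_rv_compose) auto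
  show 1: "expectation (\<lambda>\<omega>. (\<Sum>i<n. w i * g (Y i \<omega>))\<^sup>2) = (\<Sum>i<n. (w i)\<^sup>2 * expectation (\<lambda>\<omega>. (g (Y i \<omega>))\<^sup>2))"
    using g(3) bdd by (subst expectation_indep_sum_power2[OF _ ind])
      (auto intro!: bdd_rv_intros simp: power_mult_distrib)
  have "(w i)\<^sup>2 * expectation (\<lambda>\<omega>. (g (Y i \<omega>))\<^sup>2) \<le> 1 * expectation (\<lambda>\<omega>. 1)" if "i < n" for i
    using that w[of i] g(2)
    by (intro mult_mono integral_mono)
       (auto simp: abs_square_le_1 intro!: bdd_rv_integrable bdd_rv_intros bdd integral_nonneg_AE)
  then have "(\<Sum>i<n. (w i)\<^sup>2 * expectation (\<lambda>\<omega>. (g (Y i \<omega>))\<^sup>2)) \<le> (\<Sum>i<n. 1)"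
    by (intro sum_mono) (simp add: prob_space)
  then show "expectation (\<lambda>\<omega>. (\<Sum>i<n. w i * g (Y i \<omega>))\<^sup>2) \<le> n"
    unfolding 1 by simp
  have "\<bar>w i * g y\<bar> \<le> 1" for i y
    using mult_mono[OF w[of i] g(2)[of y]] by (simp add: abs_mult)
  then show "expectation (\<lambda>\<omega>. (\<Sum>i<n. w i * g (Y i \<omega>)) ^ 4) \<le> 3 * (real n)\<^sup>2"
    using expectation_indep_sum_power4_le[OF _ ind] g(3) by simp
qed

lemma centred_\<gamma>:
  shows "(\<lambda>y. \<gamma> k y - q k) \<in> borel_measurable N" "\<bar>\<gamma> k y - q k\<bar> \<le> 1"
    and "i < n \<Longrightarrow> expectation (\<lambda>\<omega>. \<gamma> k (Y i \<omega>) - q k) = 0"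
  using \<gamma>_01[of k y] q_bounds[of k]
  by (auto simp: \<gamma>_mean bdd_unit bdd_rv_integrable prob_space)

lemma abs_risk_le: "\<bar>risk k i\<bar> \<le> 1"
  by (simp add: risk_def)

lemma S_eq: "S k \<omega> = (\<Sum>i<n. risk k i * \<xi> k (Y i \<omega>))"
  unfolding S_def NN_eq N1_def by (simp add: sum_distrib_left sum_subtractf[symmetric] \<xi>_def algebra_simps)

lemma NN_dev_eq: "NN k \<omega> - m k * q k = (\<Sum>i<n. risk k i * (\<gamma> k (Y i \<omega>) - q k))"
  unfolding NN_eq m_def by (simp add: sum_distrib_right sum_subtractf right_diff_distrib)

lemma hazard_dev_eq: "h k * NN k \<omega> - D k \<omega> = (\<Sum>i<n. - e k i * (\<gamma> k (Y i \<omega>) - q k))"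
proof -
  have "(\<Sum>i<n. - e k i * (\<gamma> k (Y i \<omega>) - q k)) = q k * (\<Sum>i<n. e k i) - (\<Sum>i<n. e k i * \<gamma> k (Y i \<omega>))"
    by (simp add: sum_distrib_left sum_subtractf[symmetric] algebra_simps)
  also have "\<dots> = h k * NN k \<omega> - D k \<omega>"
    unfolding sum_e NN_eq D_def
    by (simp add: sum_distrib_left sum_subtractf[symmetric] e_def algebra_simps sum_negf[symmetric])
  finally show ?thesis ..
qed

lemma moments:
  shows S2: "expectation (\<lambda>\<omega>. (S k \<omega>)\<^sup>2) \<le> n"
    and S4: "expectation (\<lambda>\<omega>. S k \<omega> ^ 4) \<le> 3 * (real n)\<^sup>2"
    and N2: "expectation (\<lambda>\<omega>. (NN k \<omega> - m k * q k)\<^sup>2) \<le> n"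
    and N4: "expectation (\<lambda>\<omega>. (NN k \<omega> - m k * q k) ^ 4) \<le> 3 * (real n)\<^sup>2"
    and H2: "expectation (\<lambda>\<omega>. (h k * NN k \<omega> - D k \<omega>)\<^sup>2) \<le> n"
    and H4: "expectation (\<lambda>\<omega>. (h k * NN k \<omega> - D k \<omega>) ^ 4) \<le> 3 * (real n)\<^sup>2"
proof -
  have ne: "\<bar>- e k i\<bar> \<le> 1" for i using abs_e_le by simp
  show "expectation (\<lambda>\<omega>. (S k \<omega>)\<^sup>2) \<le> n" "expectation (\<lambda>\<omega>. S k \<omega> ^ 4) \<le> 3 * (real n)\<^sup>2"
    unfolding S_eq by (rule weighted_sum_moments[OF \<xi>_measurable abs_\<xi> \<xi>_mean abs_risk_le]; simp)+
  show "expectation (\<lambda>\<omega>. (NN k \<omega> - m k * q k)\<^sup>2) \<le> n"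
    "expectation (\<lambda>\<omega>. (NN k \<omega> - m k * q k) ^ 4) \<le> 3 * (real n)\<^sup>2"
    unfolding NN_dev_eq by (rule weighted_sum_moments[OF centred_\<gamma> abs_risk_le]; simp)+
  show "expectation (\<lambda>\<omega>. (h k * NN k \<omega> - D k \<omega>)\<^sup>2) \<le> n"
    "expectation (\<lambda>\<omega>. (h k * NN k \<omega> - D k \<omega>) ^ 4) \<le> 3 * (real n)\<^sup>2"
    unfolding hazard_dev_eq by (rule weighted_sum_moments[OF centred_\<gamma> ne]; simp)+
qed

lemma S2_le: "expectation (\<lambda>\<omega>. (S k \<omega>)\<^sup>2) \<le> m k * q k"
proof -
  have "expectation (\<lambda>\<omega>. (S k \<omega>)\<^sup>2) = (\<Sum>i<n. (risk k i)\<^sup>2 * expectation (\<lambda>\<omega>. (\<xi> k (Y i \<omega>))\<^sup>2))"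
    unfolding S_eq by (rule weighted_sum_moments[OF \<xi>_measurable abs_\<xi> \<xi>_mean abs_risk_le])
  also have "\<dots> \<le> (\<Sum>i<n. risk k i * q k)"
  proof (intro sum_mono)
    fix i assume "i \<in> {..<n}"
    then have i: "i < n" by simp
    have "expectation (\<lambda>\<omega>. (\<xi> k (Y i \<omega>))\<^sup>2) \<le> expectation (\<lambda>\<omega>. \<gamma> k (Y i \<omega>))"
      using i by (intro integral_mono \<xi>_square_le bdd_rv_integrable bdd_rv_intros bdd_unit)
    then show "(risk k i)\<^sup>2 * expectation (\<lambda>\<omega>. (\<xi> k (Y i \<omega>))\<^sup>2) \<le> risk k i * q k"
      using \<gamma>_mean[OF i] by (simp add: risk_def)
  qed
  finally show ?thesis
    by (simp add: m_def sum_distrib_right)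
qed

lemma abs_V_dev_le:
  "\<bar>V k \<omega> - d k * (1 - h k) * v k\<bar>
    \<le> \<bar>h k * NN k \<omega> - D k \<omega>\<bar> + \<bar>S k \<omega>\<bar> + \<bar>NN k \<omega> - m k * q k\<bar> + 1"
proof -
  define c where "c = h k * (1 - h k) * (p k * (1 - p k))"
  have c: "0 \<le> c" "c \<le> 1"
    unfolding c_def using h_bounds[of k] p_bounds[of k] by (auto intro!: mult_le_one)
  have "d k * (1 - h k) * v k = m k * q k * c"
    unfolding h_m[of k, symmetric] v_eq c_def by (simp add: algebra_simps)
  moreover have "\<bar>V k \<omega> - NN k \<omega> * c\<bar> \<le> \<bar>h k * NN k \<omega> - D k \<omega>\<bar> + \<bar>S k \<omega>\<bar> + 1"
    unfolding V_def c_def S_def using count_bounds[of k \<omega>] NN_cases[of k \<omega>] h_bounds[of k] p_bounds[of k]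
    by (intro logrank_variance_term_bound) (auto simp: NN_def)
  moreover have "\<bar>NN k \<omega> * c - m k * q k * c\<bar> \<le> \<bar>NN k \<omega> - m k * q k\<bar>"
    unfolding left_diff_distrib[symmetric] abs_mult using c by (intro mult_left_le) auto
  ultimately show ?thesis by linarith
qed

lemma V_measurable [measurable]: "V k \<in> borel_measurable M"
  unfolding V_def[abs_def] using bdd_counts[THEN bdd_rv_measurable, of k] by measurable

lemma bdd_V: "bdd_rv (V k)"
proof -
  have "bdd_rv (\<lambda>\<omega>. V k \<omega> - d k * (1 - h k) * v k)"
    by (rule bdd_rv_mono[OF _ _ abs_V_dev_le]) (auto intro!: bdd_rv_intros bdd_counts)
  from bdd_rv_add[OF this bdd_rv_const[of "d k * (1 - h k) * v k"]] show ?thesis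
    by simp
qed

lemma bdd_U: "bdd_rv U"
  unfolding U_def[abs_def] by (intro bdd_rv_sum bdd_V)

lemma expectation_abs_le_sqrt_n:
  assumes "bdd_rv X" "expectation (\<lambda>\<omega>. (X \<omega>)\<^sup>2) \<le> real n"
  shows "expectation (\<lambda>\<omega>. \<bar>X \<omega>\<bar>) \<le> sqrt n"
  using expectation_abs_le_sqrt[OF assms(1)] assms(2) by (meson order_trans real_sqrt_le_mono)

lemma expectation_U_dev_le: "expectation (\<lambda>\<omega>. \<bar>U \<omega> - s2\<bar>) \<le> K * (3 * sqrt n + 1)"
proof -
  note I = bdd_rv_integrable bdd_rv_intros bdd_counts bdd_V
  have "expectation (\<lambda>\<omega>. \<bar>V k \<omega> - d k * (1 - h k) * v k\<bar>) \<le> 3 * sqrt n + 1" for k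
  proof -
    have "expectation (\<lambda>\<omega>. \<bar>V k \<omega> - d k * (1 - h k) * v k\<bar>) \<le> expectation (\<lambda>\<omega>.
        ((\<bar>h k * NN k \<omega> - D k \<omega>\<bar> + \<bar>S k \<omega>\<bar>) + \<bar>NN k \<omega> - m k * q k\<bar>) + 1)"
      by (intro integral_mono abs_V_dev_le I)
    also have "\<dots> = expectation (\<lambda>\<omega>. \<bar>h k * NN k \<omega> - D k \<omega>\<bar>) + expectation (\<lambda>\<omega>. \<bar>S k \<omega>\<bar>)
        + expectation (\<lambda>\<omega>. \<bar>NN k \<omega> - m k * q k\<bar>) + 1"
    proof -
      have lin: "expectation (\<lambda>\<omega>. ((A \<omega> + B \<omega>) + C \<omega>) + 1) = expectation A + expectation B + expectation C + 1"
        if "bdd_rv A" "bdd_rv B" "bdd_rv C" for A B C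
        using that[THEN bdd_rv_integrable] by (simp add: prob_space)
      show ?thesis
        by (subst lin) (auto intro!: bdd_rv_intros bdd_counts)
    qed
    also have "\<dots> \<le> sqrt n + sqrt n + sqrt n + 1"
      by (intro add_mono order_refl expectation_abs_le_sqrt_n H2 S2 N2 bdd_rv_intros bdd_counts)
    finally show ?thesis by simp
  qed
  then have "(\<Sum>k<K. expectation (\<lambda>\<omega>. \<bar>V k \<omega> - d k * (1 - h k) * v k\<bar>)) \<le> (\<Sum>k<K. 3 * sqrt n + 1)"
    by (intro sum_mono)
  moreover have "expectation (\<lambda>\<omega>. \<bar>U \<omega> - s2\<bar>) \<le> expectation (\<lambda>\<omega>. \<Sum>k<K. \<bar>V k \<omega> - d k * (1 - h k) * v k\<bar>)"
  proof (rule integral_mono)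
    show "\<bar>U \<omega> - s2\<bar> \<le> (\<Sum>k<K. \<bar>V k \<omega> - d k * (1 - h k) * v k\<bar>)" for \<omega>
      unfolding U_def s2_def sum_subtractf[symmetric] by (rule sum_abs)
  qed (auto intro!: I bdd_U)
  moreover have "\<dots> = (\<Sum>k<K. expectation (\<lambda>\<omega>. \<bar>V k \<omega> - d k * (1 - h k) * v k\<bar>))"
    by (rule Bochner_Integration.integral_sum) (intro I)
  ultimately show ?thesis by simp
qed

lemma abs_Rk_le_S: "\<bar>Rk k \<omega>\<bar> \<le> \<bar>S k \<omega>\<bar>"
proof -
  have "0 \<le> D k \<omega> / NN k \<omega>" "D k \<omega> / NN k \<omega> \<le> 1"
    using count_bounds[of k \<omega>] by (auto simp: divide_le_eq intro!: divide_nonneg_nonneg)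
  then have "\<bar>h k - D k \<omega> / NN k \<omega>\<bar> \<le> 1"
    using h_bounds[of k] by linarith
  then show ?thesis
    unfolding Rk_def abs_mult by (intro mult_left_le_one_le) auto
qed

lemma bdd_Rk: "bdd_rv (Rk k)"
proof (rule bdd_rv_mono[OF _ _ abs_Rk_le_S])
  show "Rk k \<in> borel_measurable M"
    unfolding Rk_def[abs_def] using bdd_counts[THEN bdd_rv_measurable, of k] by measurable
qed (intro bdd_rv_intros bdd_counts)

lemma bdd_R: "bdd_rv R"
  unfolding R_def[abs_def] by (intro bdd_rv_sum bdd_Rk)

lemma Rk_power2_le:
  "(m k * q k)\<^sup>2 * (Rk k \<omega>)\<^sup>2
    \<le> 2 * S k \<omega> ^ 4 + (h k * NN k \<omega> - D k \<omega>) ^ 4 + (NN k \<omega> - m k * q k) ^ 4"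
proof -
  define A where "A = h k * NN k \<omega> - D k \<omega>"
  define B where "B = NN k \<omega> - m k * q k"
  have NR: "NN k \<omega> * Rk k \<omega> = A * S k \<omega>"
    using count_bounds[of k \<omega>] by (cases "NN k \<omega> = 0") (auto simp: Rk_def A_def S_def NN_def field_simps)
  have "m k * q k * Rk k \<omega> = A * S k \<omega> - B * Rk k \<omega>"
    unfolding NR[symmetric] B_def by (simp add: algebra_simps)
  then have "(m k * q k)\<^sup>2 * (Rk k \<omega>)\<^sup>2 = (A * S k \<omega> - B * Rk k \<omega>)\<^sup>2"
    by (simp add: power_mult_distrib[symmetric])
  also have "\<dots> \<le> 2 * (A * S k \<omega>)\<^sup>2 + 2 * (B * Rk k \<omega>)\<^sup>2"
    using zero_le_power2[of "A * S k \<omega> + B * Rk k \<omega>"] by (simp add: power2_diff power2_sum)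
  also have "(B * Rk k \<omega>)\<^sup>2 \<le> (B * S k \<omega>)\<^sup>2"
    using abs_Rk_le_S[of k \<omega>] by (simp add: power_mult_distrib mult_left_mono abs_le_square_iff)
  also have "2 * (A * S k \<omega>)\<^sup>2 \<le> A ^ 4 + S k \<omega> ^ 4"
    using zero_le_power2[of "A\<^sup>2 - (S k \<omega>)\<^sup>2"] by (simp add: power2_diff power_mult_distrib power_mult[symmetric])
  also have "2 * (B * S k \<omega>)\<^sup>2 \<le> B ^ 4 + S k \<omega> ^ 4"
    using zero_le_power2[of "B\<^sup>2 - (S k \<omega>)\<^sup>2"] by (simp add: power2_diff power_mult_distrib power_mult[symmetric])
  finally show ?thesis
    unfolding A_def B_def by simp
qed

lemma expectation_Rk_le:
  fixes \<epsilon> :: real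
  assumes "0 < \<epsilon>"
  shows "expectation (\<lambda>\<omega>. (Rk k \<omega>)\<^sup>2) \<le> \<epsilon> * n + 12 / \<epsilon>\<^sup>2"
proof (cases "m k * q k \<le> \<epsilon> * n")
  case True
  have "expectation (\<lambda>\<omega>. (Rk k \<omega>)\<^sup>2) \<le> expectation (\<lambda>\<omega>. (S k \<omega>)\<^sup>2)"
    using abs_Rk_le_S
    by (intro integral_mono bdd_rv_integrable bdd_rv_intros bdd_Rk bdd_counts) (simp add: abs_le_square_iff)
  also have "\<dots> \<le> \<epsilon> * n"
    using S2_le[of k] True by linarith
  finally show ?thesis
    using assms by (simp add: add_increasing2)
next
  case False
  let ?E = "expectation (\<lambda>\<omega>. (Rk k \<omega>)\<^sup>2)"
  have n: "0 < n"
    using False m_le[of k] m_nonneg[of k] by (cases n) auto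
  have "(m k * q k)\<^sup>2 * ?E = expectation (\<lambda>\<omega>. (m k * q k)\<^sup>2 * (Rk k \<omega>)\<^sup>2)"
    by simp
  also have "\<dots> \<le> expectation (\<lambda>\<omega>. 2 * S k \<omega> ^ 4 + (h k * NN k \<omega> - D k \<omega>) ^ 4 + (NN k \<omega> - m k * q k) ^ 4)"
    by (intro integral_mono Rk_power2_le bdd_rv_integrable bdd_rv_intros bdd_Rk bdd_counts)
  also have "\<dots> = 2 * expectation (\<lambda>\<omega>. S k \<omega> ^ 4) + expectation (\<lambda>\<omega>. (h k * NN k \<omega> - D k \<omega>) ^ 4)
      + expectation (\<lambda>\<omega>. (NN k \<omega> - m k * q k) ^ 4)"
  proof -
    have lin: "expectation (\<lambda>\<omega>. 2 * A \<omega> + B \<omega> + C \<omega>) = 2 * expectation A + expectation B + expectation C"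
      if "bdd_rv A" "bdd_rv B" "bdd_rv C" for A B C
      using that[THEN bdd_rv_integrable] by simp
    show ?thesis
      by (subst lin) (auto intro!: bdd_rv_intros bdd_counts)
  qed
  also have "\<dots> \<le> 12 * (real n)\<^sup>2"
    using S4[of k] H4[of k] N4[of k] by linarith
  finally have "(m k * q k)\<^sup>2 * ?E \<le> 12 * (real n)\<^sup>2" .
  moreover have "(\<epsilon> * n)\<^sup>2 * ?E \<le> (m k * q k)\<^sup>2 * ?E"
    using False assms by (intro mult_right_mono power_mono) auto
  ultimately have "\<epsilon>\<^sup>2 * ?E * (real n)\<^sup>2 \<le> 12 * (real n)\<^sup>2"
    by (simp add: power_mult_distrib mult_ac)
  then have "\<epsilon>\<^sup>2 * ?E \<le> 12"
    using n by simp
  then have "?E \<le> 12 / \<epsilon>\<^sup>2"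
    using assms by (simp add: field_simps)
  then show ?thesis
    using assms by (simp add: add_increasing)
qed

lemma expectation_R_le:
  fixes \<epsilon> :: real
  assumes "0 < \<epsilon>"
  shows "expectation (\<lambda>\<omega>. (R \<omega>)\<^sup>2) \<le> (real K)\<^sup>2 * (\<epsilon> * n + 12 / \<epsilon>\<^sup>2)"
proof -
  have "expectation (\<lambda>\<omega>. (R \<omega>)\<^sup>2) \<le> expectation (\<lambda>\<omega>. real K * (\<Sum>k<K. (Rk k \<omega>)\<^sup>2))"
  proof (rule integral_mono)
    show "(R \<omega>)\<^sup>2 \<le> real K * (\<Sum>k<K. (Rk k \<omega>)\<^sup>2)" for \<omega>
      using sum_squared_le_sum_of_squares[of "\<lambda>k. Rk k \<omega>" "{..<K}"]
      by (simp add: R_def mult.commute)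
  qed (intro bdd_rv_integrable bdd_rv_intros bdd_R bdd_Rk)+
  also have "\<dots> = real K * (\<Sum>k<K. expectation (\<lambda>\<omega>. (Rk k \<omega>)\<^sup>2))"
    by (subst integral_mult_right_zero, subst Bochner_Integration.integral_sum)
       (auto intro!: bdd_rv_integrable bdd_rv_intros bdd_Rk)
  also have "\<dots> \<le> real K * (\<Sum>k<K. \<epsilon> * n + 12 / \<epsilon>\<^sup>2)"
    by (intro mult_left_mono sum_mono expectation_Rk_le assms) simp
  finally show ?thesis
    by (simp add: power2_eq_square)
qed

lemma lin_facts:
  shows indep_lin: "indep_vars (\<lambda>_. borel) lin {..<n}"
    and abs_lin_le: "\<bar>lin i \<omega>\<bar> \<le> K"
    and lin_mean: "i < n \<Longrightarrow> expectation (lin i) = 0"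
    and bdd_lin: "i < n \<Longrightarrow> bdd_rv (lin i)"
proof -
  show "indep_vars (\<lambda>_. borel) lin {..<n}"
    unfolding lin_def[abs_def]
    by (intro indep_vars_compose2[OF indep, where Y="\<lambda>i y. \<Sum>k<K. e k i * \<xi> k y"]) measurable
  have "\<bar>lin i \<omega>\<bar> \<le> (\<Sum>k<K. \<bar>e k i * \<xi> k (Y i \<omega>)\<bar>)"
    unfolding lin_def by (rule sum_abs)
  also have "\<dots> \<le> (\<Sum>k<K. 1 * 1)"
    unfolding abs_mult by (intro sum_mono mult_mono abs_e_le abs_\<xi>) auto
  finally show "\<bar>lin i \<omega>\<bar> \<le> K" by simp
  show "bdd_rv (lin i)" if "i < n"
    unfolding lin_def[abs_def] using that by (intro bdd_rv_intros bdd_unit)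
  show "expectation (lin i) = 0" if "i < n"
    unfolding lin_def[abs_def] using that
    by (subst Bochner_Integration.integral_sum)
       (auto intro!: bdd_rv_integrable bdd_rv_intros bdd_unit simp: \<xi>_mean)
qed

lemma Lin_power2_sum: "(\<Sum>i<n. expectation (\<lambda>\<omega>. (lin i \<omega>)\<^sup>2)) = s2"
proof -
  have cov: "expectation (\<lambda>\<omega>. \<xi> k (Y i \<omega>) * \<xi> l (Y i \<omega>)) = v (max k l)" if "i < n" "k < K" "l < K" for i k l
    using \<xi>_cov[of i k l] \<xi>_cov[of i l k] that by (cases "k \<le> l") (auto simp: max_def mult.commute)
  have "expectation (\<lambda>\<omega>. (lin i \<omega>)\<^sup>2) = (\<Sum>k<K. \<Sum>l<K. e k i * e l i * v (max k l))" if i: "i < n" for i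
  proof -
    have "(lin i \<omega>)\<^sup>2 = (\<Sum>k<K. \<Sum>l<K. e k i * e l i * (\<xi> k (Y i \<omega>) * \<xi> l (Y i \<omega>)))" for \<omega>
      by (simp add: lin_def power2_eq_square sum_product mult_ac)
    then have "expectation (\<lambda>\<omega>. (lin i \<omega>)\<^sup>2)
        = (\<Sum>k<K. \<Sum>l<K. e k i * e l i * expectation (\<lambda>\<omega>. \<xi> k (Y i \<omega>) * \<xi> l (Y i \<omega>)))"
      using i by (simp add: Bochner_Integration.integral_sum bdd_rv_integrable bdd_rv_intros bdd_unit)
    then show ?thesis
      using i by (simp add: cov)
  qed
  then have "(\<Sum>i<n. expectation (\<lambda>\<omega>. (lin i \<omega>)\<^sup>2)) = (\<Sum>i<n. \<Sum>k<K. \<Sum>l<K. e k i * e l i * v (max k l))"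
    by simp
  also have "\<dots> = (\<Sum>k<K. \<Sum>l<K. (\<Sum>i<n. e k i * e l i) * v (max k l))"
    by (simp add: sum.swap[of _ "{..<n}"] sum_distrib_right)
  also have "\<dots> = (\<Sum>k<K. \<Sum>l<K. if k = l then d k * (1 - h k) * v k else 0)"
    by (intro sum.cong refl) (simp add: sum_e_e)
  also have "\<dots> = s2"
    by (simp add: s2_def)
  finally show ?thesis .
qed

lemma Lin_power2: "expectation (\<lambda>\<omega>. (Lin \<omega>)\<^sup>2) = s2"
  unfolding Lin_def using indep_lin bdd_lin lin_mean
  by (subst expectation_indep_sum_power2) (auto simp: Lin_power2_sum)

lemma bdd_Lin: "bdd_rv Lin"
  unfolding Lin_def[abs_def] by (intro bdd_rv_sum bdd_lin) simp

lemma Lin_mean: "expectation Lin = 0"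
  unfolding Lin_def[abs_def] using lin_mean bdd_lin
  by (subst Bochner_Integration.integral_sum) (auto intro: bdd_rv_integrable)

lemma variance_L:
  assumes "0 < \<delta>"
  shows "\<bar>variance L - s2\<bar> \<le> \<delta> * s2 + (1 + 1 / \<delta>) * expectation (\<lambda>\<omega>. (R \<omega>)\<^sup>2)"
  using variance_perturbation_le[OF bdd_Lin bdd_R Lin_mean assms]
  unfolding Lin_power2 L_eq[symmetric] by simp

lemma char_logrank_bound:
  assumes "0 < s2" "0 < \<epsilon>" "\<epsilon> \<le> 1 / 2"
  shows "cmod (char (distr M borel (\<lambda>\<omega>. U \<omega> powr (- 1 / 2) * L \<omega>)) x - exp (- (x\<^sup>2) / 2))
    \<le> 2 / \<epsilon> * (expectation (\<lambda>\<omega>. \<bar>U \<omega> - s2\<bar>) / s2)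
      + \<bar>x\<bar> * (2 * \<epsilon> + 2 * sqrt (expectation (\<lambda>\<omega>. (R \<omega>)\<^sup>2) / s2))
      + (\<bar>x\<bar> ^ 3 * K / (6 * sqrt s2) + x ^ 4 * (real K)\<^sup>2 / (8 * s2))"
proof -
  have s: "0 < sqrt s2" "(sqrt s2)\<^sup>2 = s2"
    using assms by auto
  have "cmod (char (distr M borel (\<lambda>\<omega>. U \<omega> powr (- 1 / 2) * L \<omega>)) x
      - char (distr M borel (\<lambda>\<omega>. Lin \<omega> / sqrt s2)) x)
    \<le> 2 / \<epsilon> * (expectation (\<lambda>\<omega>. \<bar>U \<omega> - s2\<bar>) / s2)
      + \<bar>x\<bar> * (2 * \<epsilon> + 2 * sqrt (expectation (\<lambda>\<omega>. (R \<omega>)\<^sup>2) / s2))"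
    using char_studentized_diff_le[OF bdd_U bdd_Lin bdd_R s(1) _ assms(2,3)] s(2)
    by (simp add: Lin_power2 L_eq)
  moreover have "cmod (char (distr M borel (\<lambda>\<omega>. Lin \<omega> / sqrt s2)) x - exp (- (x\<^sup>2) / 2))
    \<le> \<bar>x\<bar> ^ 3 * K / (6 * sqrt s2) + x ^ 4 * (real K)\<^sup>2 / (8 * s2)"
    using char_indep_sum_normal_bound[OF _ indep_lin abs_lin_le lin_mean s(1), of x] s(2)
    by (simp add: Lin_power2_sum Lin_def)
  ultimately show ?thesis
    using norm_triangle_ineq[of "char (distr M borel (\<lambda>\<omega>. U \<omega> powr (- 1 / 2) * L \<omega>)) x
        - char (distr M borel (\<lambda>\<omega>. Lin \<omega> / sqrt s2)) x"
        "char (distr M borel (\<lambda>\<omega>. Lin \<omega> / sqrt s2)) x - exp (- (x\<^sup>2) / 2)"]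
    by (simp only: diff_add_cancel add_diff_eq)
qed

lemma s2_ge:
  assumes "k < K"
  shows "d k * (1 - h k) * v k \<le> s2"
  unfolding s2_def using assms d_nonneg h_bounds v_nonneg
  by (intro member_le_sum[where f="\<lambda>k. d k * (1 - h k) * v k"]) auto

end

section \<open>The survival population\<close>

definition treated_at_risk :: "real \<Rightarrow> bool \<times> ereal \<times> ereal \<Rightarrow> real" where
  "treated_at_risk t y = of_bool (fst y \<and> ereal t \<le> fst (snd y))"

definition control_at_risk :: "real \<Rightarrow> bool \<times> ereal \<times> ereal \<Rightarrow> real" where
  "control_at_risk t y = of_bool (\<not> fst y \<and> ereal t \<le> snd (snd y))"

lemma treated_at_risk_eq: "treated_at_risk t = indicator ({True} \<times> {x. ereal t \<le> fst x})"
  by (auto simp: treated_at_risk_def indicator_def fun_eq_iff)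

lemma control_at_risk_eq: "control_at_risk t = indicator ({False} \<times> {x. ereal t \<le> snd x})"
  by (auto simp: control_at_risk_def indicator_def fun_eq_iff)

lemma borel_fst_ge [measurable]: "{x :: ereal \<times> ereal. c \<le> fst x} \<in> sets borel"
  by (intro borel_closed closed_Collect_le continuous_intros)

lemma borel_snd_ge [measurable]: "{x :: ereal \<times> ereal. c \<le> snd x} \<in> sets borel"
  by (intro borel_closed closed_Collect_le continuous_intros)

lemma measure_pair_bernoulli_Times:
  assumes Q: "prob_space Q" "sets Q = sets borel" and B: "B \<in> sets borel" and p: "0 \<le> p" "p \<le> 1"
  shows "measure (measure_pmf (bernoulli_pmf p) \<Otimes>\<^sub>M Q) ({z} \<times> B) = (if z then p else 1 - p) * measure Q B"
proof -
  interpret Q: prob_space Q by fact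
  have "emeasure (measure_pmf (bernoulli_pmf p) \<Otimes>\<^sub>M Q) ({z} \<times> B)
      = emeasure (measure_pmf (bernoulli_pmf p)) {z} * emeasure Q B"
    using B Q by (intro Q.emeasure_pair_measure_Times) auto
  then show ?thesis
    using p by (cases z) (simp_all add: measure_def enn2real_mult emeasure_pmf_single)
qed

lemma tval_less:
  assumes "k < l" "l < Knum n T0"
  shows "tval n T0 k < tval n T0 l"
  using assms unfolding tval_def Knum_def tvals_def
  by (intro sorted_wrt_nth_less[OF strict_sorted_list_of_set]) auto

lemma population_logrank:
  fixes M :: "'a measure" and Q :: "(ereal \<times> ereal) measure"
  defines "N \<equiv> count_space UNIV \<Otimes>\<^sub>M (borel :: (ereal \<times> ereal) measure)"
  assumes M: "prob_space M" and p: "0 < p" "p < 1" and Q: "prob_space Q" "sets Q = sets borel"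
    and rv: "\<And>i. i < n \<Longrightarrow> (\<lambda>\<omega>. (Z i \<omega>, (C1 i \<omega>, C0 i \<omega>))) \<in> measurable M N"
    and distr: "\<And>i. i < n \<Longrightarrow> distr M N (\<lambda>\<omega>. (Z i \<omega>, (C1 i \<omega>, C0 i \<omega>)))
      = measure_pmf (bernoulli_pmf p) \<Otimes>\<^sub>M Q"
    and indep: "prob_space.indep_vars M (\<lambda>_. N) (\<lambda>i \<omega>. (Z i \<omega>, (C1 i \<omega>, C0 i \<omega>))) {..<n}"
  shows "logrank M n (Knum n T0) (tval n T0) N (\<lambda>i \<omega>. (Z i \<omega>, (C1 i \<omega>, C0 i \<omega>)))
    (\<lambda>k. treated_at_risk (tval n T0 k)) (\<lambda>k. control_at_risk (tval n T0 k))
    (\<lambda>k. p * measure Q {x. ereal (tval n T0 k) \<le> fst x})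
    (\<lambda>k. (1 - p) * measure Q {x. ereal (tval n T0 k) \<le> snd x})"
proof -
  interpret prob_space M by fact
  interpret Q: prob_space Q by fact
  have sets_N: "{z} \<times> B \<in> sets N" if "B \<in> sets borel" for z B
    unfolding N_def using that by auto
  have mean: "expectation (\<lambda>\<omega>. indicator ({z} \<times> B) (Z i \<omega>, (C1 i \<omega>, C0 i \<omega>)))
      = (if z then p else 1 - p) * measure Q B" if "i < n" "B \<in> sets borel" for i z B
  proof -
    have "expectation (\<lambda>\<omega>. indicator ({z} \<times> B) (Z i \<omega>, (C1 i \<omega>, C0 i \<omega>)) :: real)
        = (\<integral>y. indicator ({z} \<times> B) y \<partial>distr M N (\<lambda>\<omega>. (Z i \<omega>, (C1 i \<omega>, C0 i \<omega>))))"
      using rv[OF that(1)] sets_N[OF that(2)] by (subst integral_distr) auto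
    also have "\<dots> = measure (distr M N (\<lambda>\<omega>. (Z i \<omega>, (C1 i \<omega>, C0 i \<omega>)))) ({z} \<times> B)"
      using sets_N[OF that(2)] by (subst Bochner_Integration.integral_indicator)
        (auto simp: sets.sets_into_space intro!: arg_cong2[where f=measure] dest: sets.sets_into_space)
    also have "\<dots> = (if z then p else 1 - p) * measure Q B"
      unfolding distr[OF that(1)] using p that by (intro measure_pair_bernoulli_Times Q) auto
    finally show ?thesis .
  qed
  show ?thesis
  proof unfold_locales
    show "indep_vars (\<lambda>_. N) (\<lambda>i \<omega>. (Z i \<omega>, (C1 i \<omega>, C0 i \<omega>))) {..<n}"
      by (rule indep)
    show "treated_at_risk (tval n T0 k) \<in> borel_measurable N"
      "control_at_risk (tval n T0 k) \<in> borel_measurable N" for k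
      unfolding treated_at_risk_eq control_at_risk_eq
      by (auto intro!: borel_measurable_indicator sets_N)
    show "i < n \<Longrightarrow> expectation (\<lambda>\<omega>. treated_at_risk (tval n T0 k) (Z i \<omega>, (C1 i \<omega>, C0 i \<omega>)))
        = p * measure Q {x. ereal (tval n T0 k) \<le> fst x}" for i k
      unfolding treated_at_risk_eq by (subst mean) auto
    show "i < n \<Longrightarrow> expectation (\<lambda>\<omega>. control_at_risk (tval n T0 k) (Z i \<omega>, (C1 i \<omega>, C0 i \<omega>)))
        = (1 - p) * measure Q {x. ereal (tval n T0 k) \<le> snd x}" for i k
      unfolding control_at_risk_eq by (subst mean) auto
    show "p * measure Q {x. ereal (tval n T0 k) \<le> fst x}
        + (1 - p) * measure Q {x. ereal (tval n T0 k) \<le> snd x} \<le> 1" for k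
    proof -
      have "p * measure Q {x. ereal (tval n T0 k) \<le> fst x} \<le> p * 1"
        "(1 - p) * measure Q {x. ereal (tval n T0 k) \<le> snd x} \<le> (1 - p) * 1"
        using p by (intro mult_left_mono Q.prob_le_1; simp)+
      then show ?thesis by simp
    qed
    show "k < l \<Longrightarrow> l < Knum n T0 \<Longrightarrow> tval n T0 k < tval n T0 l" for k l
      by (rule tval_less)
    fix k l y assume kl: "k \<le> l" "l < Knum n T0"
    then have "tval n T0 k \<le> tval n T0 l"
      using tval_less[of k l n T0] by (cases "k = l") auto
    then have le: "ereal (tval n T0 l) \<le> c \<Longrightarrow> ereal (tval n T0 k) \<le> c" for c
      by (meson ereal_less_eq(3) order_trans)
    show "treated_at_risk (tval n T0 k) y * treated_at_risk (tval n T0 l) y = treated_at_risk (tval n T0 l) y"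
      "control_at_risk (tval n T0 k) y * control_at_risk (tval n T0 l) y = control_at_risk (tval n T0 l) y"
      using le by (auto simp: treated_at_risk_def control_at_risk_def)
  qed (use p in \<open>auto simp: treated_at_risk_def control_at_risk_def\<close>)
qed

lemma real_card_eq_sum:
  fixes n :: nat
  shows "real (card {i\<in>{..<n}. P i}) = (\<Sum>i<n. of_bool (P i))"
proof -
  have "{i\<in>{..<n}. P i} = {..<n} \<inter> {i. P i}" by blast
  then show ?thesis by simp
qed

lemma ereal_le_min_iff: "ereal \<tau> \<le> min (ereal x) c \<longleftrightarrow> \<tau> \<le> x \<and> ereal \<tau> \<le> c"
  by simp

lemma ereal_min_eq_iff: "ereal x \<le> c \<and> min (ereal x) c = ereal \<tau> \<longleftrightarrow> x = \<tau> \<and> ereal \<tau> \<le> c"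
  by (auto simp: min_def)

lemma counts_eq_sums:
  assumes H0: "\<forall>i<n. T1 i = T0 i"
  shows "N1k n T1 T0 z c1 c0 k
      = (\<Sum>i<n. of_bool (tval n T0 k \<le> T0 i) * treated_at_risk (tval n T0 k) (z i, c1 i, c0 i))"
    and "N0k n T1 T0 z c1 c0 k
      = (\<Sum>i<n. of_bool (tval n T0 k \<le> T0 i) * control_at_risk (tval n T0 k) (z i, c1 i, c0 i))"
    and "D1k n T1 T0 z c1 c0 k
      = (\<Sum>i<n. of_bool (T0 i = tval n T0 k) * treated_at_risk (tval n T0 k) (z i, c1 i, c0 i))"
    and "Dk n T1 T0 z c1 c0 k
      = (\<Sum>i<n. of_bool (T0 i = tval n T0 k) *
          (treated_at_risk (tval n T0 k) (z i, c1 i, c0 i) + control_at_risk (tval n T0 k) (z i, c1 i, c0 i)))"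
  unfolding N1k_def N0k_def D1k_def Dk_def real_card_eq_sum Wobs_def Dobs_def ereal_min_eq_iff ereal_le_min_iff
  by (intro sum.cong refl; auto simp: H0 treated_at_risk_def control_at_risk_def Tobs_def Cobs_def)+

text \<open>\<open>s2\<close> is the variance of the linear part and \<open>\<rho>\<close> the mean square of the linearization error.\<close>

lemma population_bounds:
  fixes M :: "'a measure" and Q :: "(ereal \<times> ereal) measure"
    and n :: nat and p :: real and T1 T0 :: "nat \<Rightarrow> real" and Z :: "nat \<Rightarrow> 'a \<Rightarrow> bool" and C1 C0 :: "nat \<Rightarrow> 'a \<Rightarrow> ereal"
  defines "N \<equiv> count_space UNIV \<Otimes>\<^sub>M (borel :: (ereal \<times> ereal) measure)"
    and "L \<equiv> \<lambda>\<omega>. Lstat n T1 T0 (\<lambda>i. Z i \<omega>) (\<lambda>i. C1 i \<omega>) (\<lambda>i. C0 i \<omega>)"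
    and "U \<equiv> \<lambda>\<omega>. Ustat n T1 T0 (\<lambda>i. Z i \<omega>) (\<lambda>i. C1 i \<omega>) (\<lambda>i. C0 i \<omega>)"
    and "a \<equiv> \<lambda>k. p * measure Q {x. ereal (tval n T0 k) \<le> fst x}"
    and "b \<equiv> \<lambda>k. (1 - p) * measure Q {x. ereal (tval n T0 k) \<le> snd x}"
    and "K \<equiv> Knum n T0"
  assumes M: "prob_space M" and H0: "\<And>i. i < n \<Longrightarrow> T1 i = T0 i"
    and p: "0 < p" "p < 1" and Q: "prob_space Q" "sets Q = sets borel"
    and rv: "\<And>i. i < n \<Longrightarrow> (\<lambda>\<omega>. (Z i \<omega>, (C1 i \<omega>, C0 i \<omega>))) \<in> measurable M N"
    and distr: "\<And>i. i < n \<Longrightarrow> distr M N (\<lambda>\<omega>. (Z i \<omega>, (C1 i \<omega>, C0 i \<omega>)))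
      = measure_pmf (bernoulli_pmf p) \<Otimes>\<^sub>M Q"
    and indep: "prob_space.indep_vars M (\<lambda>_. N) (\<lambda>i \<omega>. (Z i \<omega>, (C1 i \<omega>, C0 i \<omega>))) {..<n}"
  shows "\<exists>s2 \<rho>. 0 \<le> \<rho> \<and> integrable M U \<and> L \<in> borel_measurable M \<and>
    (\<forall>k<K. dcount n T0 k * (1 - hrate n T0 k) * (a k * b k / (a k + b k)) \<le> s2) \<and>
    (\<integral>\<omega>. \<bar>U \<omega> - s2\<bar> \<partial>M) \<le> K * (3 * sqrt n + 1) \<and>
    (\<forall>\<epsilon>::real. 0 < \<epsilon> \<longrightarrow> \<rho> \<le> (real K)\<^sup>2 * (\<epsilon> * n + 12 / \<epsilon>\<^sup>2)) \<and>
    (\<forall>\<delta>>0. \<bar>prob_space.variance M L - s2\<bar> \<le> \<delta> * s2 + (1 + 1 / \<delta>) * \<rho>) \<and>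
    (0 < s2 \<longrightarrow> (\<forall>\<epsilon> (x::real). 0 < \<epsilon> \<longrightarrow> \<epsilon> \<le> 1 / 2 \<longrightarrow>
      cmod (char (distr M borel (\<lambda>\<omega>. U \<omega> powr (- 1 / 2) * L \<omega>)) x - complex_of_real (exp (- (x\<^sup>2) / 2)))
        \<le> 2 / \<epsilon> * (K * (3 * sqrt n + 1) / s2) + \<bar>x\<bar> * (2 * \<epsilon> + 2 * sqrt (\<rho> / s2))
          + (\<bar>x\<bar> ^ 3 * K / (6 * sqrt s2) + x ^ 4 * (real K)\<^sup>2 / (8 * s2))))"
proof -
  interpret lr: logrank M n K T0 "tval n T0" N "\<lambda>i \<omega>. (Z i \<omega>, (C1 i \<omega>, C0 i \<omega>))"
    "\<lambda>k. treated_at_risk (tval n T0 k)" "\<lambda>k. control_at_risk (tval n T0 k)" a b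
    unfolding N_def a_def b_def K_def
    by (rule population_logrank) (use assms in \<open>simp_all add: N_def\<close>)
  have d: "dcount n T0 k = lr.d k" for k
    unfolding dcount_def lr.d_def lr.ev_def real_card_eq_sum ..
  have m: "ncount n T0 k = lr.m k" for k
    unfolding ncount_def lr.m_def lr.risk_def real_card_eq_sum ..
  have H0': "\<forall>i<n. T1 i = T0 i"
    using H0 by blast
  have L: "L = lr.L" and U: "U = lr.U"
    unfolding L_def U_def fun_eq_iff Lstat_def Ustat_def Mk_def Vk_def Nk_def counts_eq_sums[OF H0'] K_def[symmetric]
      lr.L_def lr.U_def lr.V_def lr.NN_def lr.N1_def lr.N0_def lr.D1_def lr.D_def lr.ev_def lr.risk_def lr.\<gamma>_def
    by simp_all
  have "lr.L \<in> borel_measurable M"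
    using lr.bdd_rv_measurable[OF lr.bdd_Lin] lr.bdd_rv_measurable[OF lr.bdd_R]
    by (simp add: lr.L_eq[abs_def])
  moreover have "0 \<le> lr.expectation (\<lambda>\<omega>. (lr.R \<omega>)\<^sup>2)"
    by simp
  moreover have "lr.d k * (1 - lr.h k) * (a k * b k / (a k + b k)) \<le> lr.s2" if "k < K" for k
    using lr.s2_ge[OF that] by (simp add: lr.v_def lr.q_def)
  moreover have "cmod (char (distr M borel (\<lambda>\<omega>. lr.U \<omega> powr (- 1 / 2) * lr.L \<omega>)) x - complex_of_real (exp (- (x\<^sup>2) / 2)))
        \<le> 2 / \<epsilon> * (K * (3 * sqrt n + 1) / lr.s2)
          + \<bar>x\<bar> * (2 * \<epsilon> + 2 * sqrt (lr.expectation (\<lambda>\<omega>. (lr.R \<omega>)\<^sup>2) / lr.s2))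
          + (\<bar>x\<bar> ^ 3 * K / (6 * sqrt lr.s2) + x ^ 4 * (real K)\<^sup>2 / (8 * lr.s2))"
    if "0 < lr.s2" "0 < \<epsilon>" "\<epsilon> \<le> 1 / 2" for \<epsilon> x :: real
  proof -
    have "2 / \<epsilon> * (lr.expectation (\<lambda>\<omega>. \<bar>lr.U \<omega> - lr.s2\<bar>) / lr.s2) \<le> 2 / \<epsilon> * (K * (3 * sqrt n + 1) / lr.s2)"
      using that lr.expectation_U_dev_le by (intro mult_left_mono divide_right_mono) auto
    with lr.char_logrank_bound[OF that, of x] show ?thesis
      by linarith
  qed
  ultimately show ?thesis
    unfolding L U d hrate_def m
    by (intro exI[of _ lr.s2] exI[of _ "lr.expectation (\<lambda>\<omega>. (lr.R \<omega>)\<^sup>2)"])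
       (auto simp: lr.h_def intro: lr.expectation_R_le lr.expectation_U_dev_le lr.variance_L
          lr.bdd_rv_integrable[OF lr.bdd_U])
qed

lemma tendsto_zero_if_bounded_by_small:
  fixes f :: "nat \<Rightarrow> real"
  assumes "\<forall>\<^sub>F n in sequentially. 0 \<le> f n"
    and "\<And>\<epsilon>. 0 < \<epsilon> \<Longrightarrow> \<epsilon> \<le> 1 / 2 \<Longrightarrow> \<exists>g. g \<longlonglongrightarrow> C * \<epsilon> \<and> (\<forall>\<^sub>F n in sequentially. f n \<le> g n)"
    and "0 \<le> C"
  shows "f \<longlonglongrightarrow> 0"
proof (rule order_tendstoI)
  fix r :: real assume "r < 0"
  with assms(1) show "\<forall>\<^sub>F n in sequentially. r < f n"
    by (auto elim: eventually_mono)
next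
  fix r :: real assume r: "0 < r"
  define \<epsilon> where "\<epsilon> = min (1 / 2) (r / (2 * (C + 1)))"
  have \<epsilon>: "0 < \<epsilon>" "\<epsilon> \<le> 1 / 2"
    using r \<open>0 \<le> C\<close> unfolding \<epsilon>_def by (simp_all only: min.cobounded1) simp
  then obtain g where g: "g \<longlonglongrightarrow> C * \<epsilon>" "\<forall>\<^sub>F n in sequentially. f n \<le> g n"
    using assms(2) by blast
  have "C * \<epsilon> \<le> C * (r / (2 * (C + 1)))"
    using \<open>0 \<le> C\<close> by (intro mult_left_mono) (auto simp: \<epsilon>_def)
  also have "\<dots> < r"
    using r \<open>0 \<le> C\<close> by (simp add: field_simps add_nonneg_pos)
  finally have "\<forall>\<^sub>F n in sequentially. g n < r"
    by (rule order_tendstoD(2)[OF g(1)])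
  with g(2) show "\<forall>\<^sub>F n in sequentially. f n < r"
    by eventually_elim linarith
qed

lemma (in prob_space) prob_ratio_dev_le:
  assumes U: "integrable M U" and s: "0 < s" and e: "0 < e" "e \<le> 1" and w: "\<bar>w / s - 1\<bar> \<le> e / 4"
  shows "measure M {\<omega>\<in>space M. \<bar>U \<omega> / w - 1\<bar> > e} \<le> 4 / e * (expectation (\<lambda>\<omega>. \<bar>U \<omega> - s\<bar>) / s)"
proof -
  note [measurable] = borel_measurable_integrable[OF U]
  have "w - s = s * (w / s - 1)"
    using s by (simp add: right_diff_distrib)
  then have "\<bar>w - s\<bar> = s * \<bar>w / s - 1\<bar>"
    using s by (simp only: abs_mult abs_of_pos)
  also have "\<dots> \<le> s * (e / 4)"
    using w s by (intro mult_left_mono) auto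
  finally have ws: "\<bar>w - s\<bar> \<le> s * e / 4" by simp
  have "s * e \<le> s * 1"
    using s e by (intro mult_left_mono) auto
  then have wpos: "s / 2 \<le> w"
    using ws by linarith
  have incl: "e * s / 4 \<le> \<bar>U \<omega> - s\<bar>" if "\<bar>U \<omega> / w - 1\<bar> > e" for \<omega>
  proof -
    have "0 < w" using wpos s by linarith
    have "e * (s / 2) \<le> e * w"
      using wpos e by (intro mult_left_mono) auto
    also have "\<dots> < \<bar>U \<omega> / w - 1\<bar> * w"
      using that \<open>0 < w\<close> by (intro mult_strict_right_mono)
    also have "\<dots> = \<bar>(U \<omega> / w - 1) * w\<bar>"
      using \<open>0 < w\<close> by (simp add: abs_mult)
    also have "(U \<omega> / w - 1) * w = (U \<omega> - s) - (w - s)"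
      using \<open>0 < w\<close> by (simp add: left_diff_distrib)
    finally have "e * (s / 2) < \<bar>(U \<omega> - s) - (w - s)\<bar>" .
    moreover have "\<bar>(U \<omega> - s) - (w - s)\<bar> \<le> \<bar>U \<omega> - s\<bar> + s * e / 4"
      using ws by linarith
    ultimately show ?thesis
      by (simp add: mult.commute)
  qed
  have "measure M {\<omega>\<in>space M. \<bar>U \<omega> / w - 1\<bar> > e} \<le> measure M {\<omega>\<in>space M. e * s / 4 \<le> \<bar>U \<omega> - s\<bar>}"
    using incl by (intro finite_measure_mono) auto
  also have "\<dots> \<le> expectation (\<lambda>\<omega>. \<bar>U \<omega> - s\<bar>) / (e * s / 4)"
    using U s e by (intro integral_Markov_inequality_measure[of _ _ "{}"]) auto
  finally show ?thesis
    using s e by (simp add: field_simps)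
qed

theorem theorem5:
  fixes M :: "nat \<Rightarrow> 'a measure"
    and T1 T0 :: "nat \<Rightarrow> nat \<Rightarrow> real"
    and Z :: "nat \<Rightarrow> nat \<Rightarrow> 'a \<Rightarrow> bool"
    and C1 C0 :: "nat \<Rightarrow> nat \<Rightarrow> 'a \<Rightarrow> ereal"
    and p1 :: "nat \<Rightarrow> real"
    and Q :: "nat \<Rightarrow> (ereal \<times> ereal) measure"
    and K :: nat
  assumes prob: "\<And>n. prob_space (M n)"
    and T_nonneg: "\<And>n i. i < n \<Longrightarrow> 0 \<le> T1 n i \<and> 0 \<le> T0 n i"
    and H0: "\<And>n i. i < n \<Longrightarrow> T1 n i = T0 n i"
    and C_nonneg: "\<And>n i \<omega>. i < n \<Longrightarrow> \<omega> \<in> space (M n) \<Longrightarrow> 0 \<le> C1 n i \<omega> \<and> 0 \<le> C0 n i \<omega>"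
    and p1_range: "\<And>n. 0 < p1 n \<and> p1 n < 1"
    and Q_prob: "\<And>n. prob_space (Q n)"
    and Q_sets: "\<And>n. sets (Q n) = sets (borel :: (ereal \<times> ereal) measure)"
    and unit_rv: "\<And>n i. i < n \<Longrightarrow>
        (\<lambda>\<omega>. (Z n i \<omega>, (C1 n i \<omega>, C0 n i \<omega>)))
          \<in> measurable (M n) (count_space UNIV \<Otimes>\<^sub>M (borel :: (ereal \<times> ereal) measure))"
    and unit_distr: "\<And>n i. i < n \<Longrightarrow>
        distr (M n) (count_space UNIV \<Otimes>\<^sub>M (borel :: (ereal \<times> ereal) measure))
              (\<lambda>\<omega>. (Z n i \<omega>, (C1 n i \<omega>, C0 n i \<omega>)))
          = measure_pmf (bernoulli_pmf (p1 n)) \<Otimes>\<^sub>M Q n"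
    and units_indep: "\<And>n. prob_space.indep_vars (M n)
        (\<lambda>_. count_space UNIV \<Otimes>\<^sub>M (borel :: (ereal \<times> ereal) measure))
        (\<lambda>i \<omega>. (Z n i \<omega>, (C1 n i \<omega>, C0 n i \<omega>))) {..<n}"
    \<comment> \<open>Condition 2\<close>
    and K_fixed: "\<forall>\<^sub>F n in sequentially. Knum n (T0 n) = K"
    and lim_p1: "\<exists>a>0. p1 \<longlonglongrightarrow> a"
    and lim_p0: "\<exists>b>0. (\<lambda>n. 1 - p1 n) \<longlonglongrightarrow> b"
    and lim_d: "\<And>k. k < K \<Longrightarrow> convergent (\<lambda>n. dcount n (T0 n) k / real n)"
    and lim_G1: "\<And>k. k < K \<Longrightarrow>
        convergent (\<lambda>n. measure (Q n) {x. ereal (tval n (T0 n) k) \<le> fst x})"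
    and lim_G0: "\<And>k. k < K \<Longrightarrow>
        convergent (\<lambda>n. measure (Q n) {x. ereal (tval n (T0 n) k) \<le> snd x})"
    and pos_k: "\<exists>k < K.
        (\<exists>a>0. (\<lambda>n. dcount n (T0 n) k / real n) \<longlonglongrightarrow> a) \<and>
        (\<exists>g1>0. (\<lambda>n. measure (Q n) {x. ereal (tval n (T0 n) k) \<le> fst x}) \<longlonglongrightarrow> g1) \<and>
        (\<exists>g0>0. (\<lambda>n. measure (Q n) {x. ereal (tval n (T0 n) k) \<le> snd x}) \<longlonglongrightarrow> g0) \<and>
        (\<exists>h<1. (\<lambda>n. hrate n (T0 n) k) \<longlonglongrightarrow> h)"
  shows "conv_in_prob_const M
           (\<lambda>n \<omega>. Ustat n (T1 n) (T0 n) (\<lambda>i. Z n i \<omega>) (\<lambda>i. C1 n i \<omega>) (\<lambda>i. C0 n i \<omega>)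
                  / prob_space.variance (M n)
                      (\<lambda>\<omega>'. Lstat n (T1 n) (T0 n) (\<lambda>i. Z n i \<omega>') (\<lambda>i. C1 n i \<omega>') (\<lambda>i. C0 n i \<omega>')))
           1
       \<and> weak_conv_m
           (\<lambda>n. distr (M n) borel
              (\<lambda>\<omega>. Ustat n (T1 n) (T0 n) (\<lambda>i. Z n i \<omega>) (\<lambda>i. C1 n i \<omega>) (\<lambda>i. C0 n i \<omega>) powr (-1/2)
                   * Lstat n (T1 n) (T0 n) (\<lambda>i. Z n i \<omega>) (\<lambda>i. C1 n i \<omega>) (\<lambda>i. C0 n i \<omega>)))
           std_normal_distribution"
proof -
  define L where "L n \<omega> = Lstat n (T1 n) (T0 n) (\<lambda>i. Z n i \<omega>) (\<lambda>i. C1 n i \<omega>) (\<lambda>i. C0 n i \<omega>)" for n \<omega>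
  define U where "U n \<omega> = Ustat n (T1 n) (T0 n) (\<lambda>i. Z n i \<omega>) (\<lambda>i. C1 n i \<omega>) (\<lambda>i. C0 n i \<omega>)" for n \<omega>
  define a where "a n k = p1 n * measure (Q n) {x. ereal (tval n (T0 n) k) \<le> fst x}" for n k
  define b where "b n k = (1 - p1 n) * measure (Q n) {x. ereal (tval n (T0 n) k) \<le> snd x}" for n k
  define Kn where "Kn n = Knum n (T0 n)" for n
  define B where "B n s2 \<rho> \<longleftrightarrow> 0 \<le> \<rho> \<and> integrable (M n) (U n) \<and> L n \<in> borel_measurable (M n) \<and>
    (\<forall>k<Kn n. dcount n (T0 n) k * (1 - hrate n (T0 n) k) * (a n k * b n k / (a n k + b n k)) \<le> s2) \<and>
    (\<integral>\<omega>. \<bar>U n \<omega> - s2\<bar> \<partial>M n) \<le> Kn n * (3 * sqrt n + 1) \<and>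
    (\<forall>\<epsilon>::real. 0 < \<epsilon> \<longrightarrow> \<rho> \<le> (real (Kn n))\<^sup>2 * (\<epsilon> * n + 12 / \<epsilon>\<^sup>2)) \<and>
    (\<forall>\<delta>>0. \<bar>prob_space.variance (M n) (L n) - s2\<bar> \<le> \<delta> * s2 + (1 + 1 / \<delta>) * \<rho>) \<and>
    (0 < s2 \<longrightarrow> (\<forall>\<epsilon> (x::real). 0 < \<epsilon> \<longrightarrow> \<epsilon> \<le> 1 / 2 \<longrightarrow>
      cmod (char (distr (M n) borel (\<lambda>\<omega>. U n \<omega> powr (- 1 / 2) * L n \<omega>)) x - complex_of_real (exp (- (x\<^sup>2) / 2)))
        \<le> 2 / \<epsilon> * (Kn n * (3 * sqrt n + 1) / s2) + \<bar>x\<bar> * (2 * \<epsilon> + 2 * sqrt (\<rho> / s2))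
          + (\<bar>x\<bar> ^ 3 * Kn n / (6 * sqrt s2) + x ^ 4 * (real (Kn n))\<^sup>2 / (8 * s2))))" for n s2 \<rho>
  have "\<exists>s2 \<rho>. B n s2 \<rho>" for n
    using population_bounds[where M="M n" and n=n and ?T1.0="T1 n" and ?T0.0="T0 n" and Z="Z n"
          and ?C1.0="C1 n" and ?C0.0="C0 n" and p="p1 n" and Q="Q n", OF prob H0 _ _ Q_prob Q_sets
          unit_rv unit_distr units_indep] p1_range[of n]
    unfolding B_def L_def[abs_def] U_def[abs_def] a_def b_def Kn_def by simp
  then obtain s2 \<rho> where "\<And>n. B n (s2 n) (\<rho> n)"
    by metis
  note B = this[unfolded B_def]
  note \<rho>0 = B[THEN conjunct1] and B1 = B[THEN conjunct2]
  note Uint = B1[THEN conjunct1] and B2 = B1[THEN conjunct2]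
  note Lmeas = B2[THEN conjunct1] and B3 = B2[THEN conjunct2]
  note s2_ge = B3[THEN conjunct1, rule_format] and B4 = B3[THEN conjunct2]
  note Udev = B4[THEN conjunct1] and B5 = B4[THEN conjunct2]
  note \<rho>le = B5[THEN conjunct1, rule_format] and B6 = B5[THEN conjunct2]
  note var = B6[THEN conjunct1, rule_format] and chr = B6[THEN conjunct2, rule_format]
  have K: "\<forall>\<^sub>F n in sequentially. Kn n = K"
    using K_fixed by (simp add: Kn_def)

  obtain c where c: "0 < c" "\<forall>\<^sub>F n in sequentially. c * real n \<le> s2 n"
  proof -
    obtain k \<delta> g1 g0 \<eta> where k: "k < K"
      and pos: "0 < \<delta>" "0 < g1" "0 < g0" "\<eta> < 1"
      and lims: "(\<lambda>n. dcount n (T0 n) k / real n) \<longlonglongrightarrow> \<delta>"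
        "(\<lambda>n. measure (Q n) {x. ereal (tval n (T0 n) k) \<le> fst x}) \<longlonglongrightarrow> g1"
        "(\<lambda>n. measure (Q n) {x. ereal (tval n (T0 n) k) \<le> snd x}) \<longlonglongrightarrow> g0"
        "(\<lambda>n. hrate n (T0 n) k) \<longlonglongrightarrow> \<eta>"
      using pos_k by blast
    obtain \<pi>1 \<pi>0 where \<pi>: "0 < \<pi>1" "p1 \<longlonglongrightarrow> \<pi>1" "0 < \<pi>0" "(\<lambda>n. 1 - p1 n) \<longlonglongrightarrow> \<pi>0"
      using lim_p1 lim_p0 by blast
    define l where "l = \<delta> * (1 - \<eta>) * ((\<pi>1 * g1) * (\<pi>0 * g0) / (\<pi>1 * g1 + \<pi>0 * g0))"
    have ab: "0 < \<pi>1 * g1" "0 < \<pi>0 * g0"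
      using pos \<pi> by auto
    then have "0 < l"
      using pos by (simp add: l_def)
    have "(\<lambda>n. dcount n (T0 n) k / real n * (1 - hrate n (T0 n) k) * (a n k * b n k / (a n k + b n k))) \<longlonglongrightarrow> l"
      unfolding l_def a_def b_def using ab by (intro tendsto_intros lims \<pi>) auto
    then have "\<forall>\<^sub>F n in sequentially. l / 2 <
        dcount n (T0 n) k / real n * (1 - hrate n (T0 n) k) * (a n k * b n k / (a n k + b n k))"
      using \<open>0 < l\<close> by (intro order_tendstoD(1)) auto
    then have "\<forall>\<^sub>F n in sequentially. l / 2 * real n \<le> s2 n"
      using K eventually_gt_at_top[of 0]
    proof eventually_elim
      case (elim n)
      have "l / 2 * real n
          \<le> (dcount n (T0 n) k / real n * (1 - hrate n (T0 n) k) * (a n k * b n k / (a n k + b n k))) * real n"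
        using elim by (intro mult_right_mono) auto
      also have "\<dots> = dcount n (T0 n) k * (1 - hrate n (T0 n) k) * (a n k * b n k / (a n k + b n k))"
        using elim by simp
      also have "\<dots> \<le> s2 n"
        using elim k by (intro s2_ge) simp
      finally show ?case .
    qed
    with \<open>0 < l\<close> show ?thesis by (intro that[of "l / 2"]) auto
  qed
  have ev: "\<forall>\<^sub>F n in sequentially. 0 < n \<and> Kn n = K \<and> 0 < s2 n \<and> c * real n \<le> s2 n"
    using c(2) K eventually_gt_at_top[of 0]
  proof eventually_elim
    case (elim n)
    then have "0 < c * real n" using c(1) by simp
    with elim show ?case by linarith
  qed

  have \<rho>_lim: "(\<lambda>n. \<rho> n / s2 n) \<longlonglongrightarrow> 0"
  proof (rule tendsto_zero_if_bounded_by_small[where C="(real K)\<^sup>2 / c"])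
    show "\<forall>\<^sub>F n in sequentially. 0 \<le> \<rho> n / s2 n"
      using ev \<rho>0 by (auto elim: eventually_mono)
    fix \<epsilon> :: real assume \<epsilon>: "0 < \<epsilon>"
    have "(\<lambda>n. (real K)\<^sup>2 * (\<epsilon> + 12 / \<epsilon>\<^sup>2 * (1 / real n)) / c) \<longlonglongrightarrow> (real K)\<^sup>2 * (\<epsilon> + 12 / \<epsilon>\<^sup>2 * 0) / c"
      using c by (intro tendsto_intros lim_1_over_n) auto
    moreover have "\<forall>\<^sub>F n in sequentially. \<rho> n / s2 n \<le> (real K)\<^sup>2 * (\<epsilon> + 12 / \<epsilon>\<^sup>2 * (1 / real n)) / c"
      using ev
    proof eventually_elim
      case (elim n)
      have "\<rho> n / s2 n \<le> ((real K)\<^sup>2 * (\<epsilon> * n + 12 / \<epsilon>\<^sup>2)) / (c * n)"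
        using elim \<rho>le[OF \<epsilon>, of n] c \<rho>0 \<epsilon> by (intro frac_le) auto
      also have "\<dots> = (real K)\<^sup>2 * (\<epsilon> + 12 / \<epsilon>\<^sup>2 * (1 / real n)) / c"
        using elim c \<epsilon> by (simp add: field_simps)
      finally show ?case .
    qed
    ultimately show "\<exists>g. g \<longlonglongrightarrow> (real K)\<^sup>2 / c * \<epsilon> \<and> (\<forall>\<^sub>F n in sequentially. \<rho> n / s2 n \<le> g n)"
      by auto
  qed (use c in simp)

  have inv_sqrt: "(\<lambda>n. 1 / sqrt (real n)) \<longlonglongrightarrow> 0"
    by (intro tendsto_divide_0[OF tendsto_const] filterlim_at_top_imp_at_infinity
        filterlim_compose[OF sqrt_at_top filterlim_real_sequentially])
  have U_lim: "(\<lambda>n. Kn n * (3 * sqrt n + 1) / s2 n) \<longlonglongrightarrow> 0"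
  proof (rule tendsto_sandwich[OF _ _ tendsto_const])
    show "\<forall>\<^sub>F n in sequentially. 0 \<le> Kn n * (3 * sqrt n + 1) / s2 n"
      using ev by (auto elim!: eventually_mono)
    show "\<forall>\<^sub>F n in sequentially. Kn n * (3 * sqrt n + 1) / s2 n
        \<le> K / c * (3 * (1 / sqrt (real n)) + 1 / real n)"
      using ev
    proof eventually_elim
      case (elim n)
      have "Kn n * (3 * sqrt n + 1) / s2 n \<le> K * (3 * sqrt n + 1) / (c * n)"
        using elim c by (intro frac_le) auto
      also have "\<dots> = K / c * (3 * (sqrt n / n) + 1 / n)"
        using elim c by (simp add: field_simps)
      also have "sqrt n / n = 1 / sqrt (real n)"
        using elim by (simp add: field_simps)
      finally show ?case .
    qed
    have "(\<lambda>n. K / c * (3 * (1 / sqrt (real n)) + 1 / real n)) \<longlonglongrightarrow> K / c * (3 * 0 + 0)"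
      by (intro tendsto_intros inv_sqrt lim_1_over_n)
    then show "(\<lambda>n. K / c * (3 * (1 / sqrt (real n)) + 1 / real n)) \<longlonglongrightarrow> 0"
      by simp
  qed
  have E_lim: "(\<lambda>n. (\<integral>\<omega>. \<bar>U n \<omega> - s2 n\<bar> \<partial>M n) / s2 n) \<longlonglongrightarrow> 0"
  proof (rule tendsto_sandwich[OF _ _ tendsto_const U_lim])
    show "\<forall>\<^sub>F n in sequentially. 0 \<le> (\<integral>\<omega>. \<bar>U n \<omega> - s2 n\<bar> \<partial>M n) / s2 n"
      using ev by (auto elim!: eventually_mono)
    show "\<forall>\<^sub>F n in sequentially. (\<integral>\<omega>. \<bar>U n \<omega> - s2 n\<bar> \<partial>M n) / s2 n \<le> Kn n * (3 * sqrt n + 1) / s2 n"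
      using ev by eventually_elim (intro divide_right_mono Udev, auto)
  qed
  have s2_lim: "(\<lambda>n. 1 / s2 n) \<longlonglongrightarrow> 0"
  proof (rule tendsto_sandwich[OF _ _ tendsto_const])
    show "\<forall>\<^sub>F n in sequentially. 0 \<le> 1 / s2 n"
      using ev by (auto elim!: eventually_mono)
    show "\<forall>\<^sub>F n in sequentially. 1 / s2 n \<le> 1 / c * (1 / real n)"
      using ev
    proof eventually_elim
      case (elim n)
      then have "1 / s2 n \<le> 1 / (c * real n)"
        using c by (intro frac_le) auto
      then show ?case by simp
    qed
    show "(\<lambda>n. 1 / c * (1 / real n)) \<longlonglongrightarrow> 0"
      using tendsto_mult[OF tendsto_const[of "1 / c"] lim_1_over_n] by simp
  qed

  have var_lim: "(\<lambda>n. \<bar>prob_space.variance (M n) (L n) / s2 n - 1\<bar>) \<longlonglongrightarrow> 0"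
  proof (rule tendsto_zero_if_bounded_by_small[where C=1])
    fix \<delta> :: real assume \<delta>: "0 < \<delta>"
    have "(\<lambda>n. \<delta> + (1 + 1 / \<delta>) * (\<rho> n / s2 n)) \<longlonglongrightarrow> \<delta> + (1 + 1 / \<delta>) * 0"
      by (intro tendsto_intros \<rho>_lim)
    moreover have "\<forall>\<^sub>F n in sequentially.
        \<bar>prob_space.variance (M n) (L n) / s2 n - 1\<bar> \<le> \<delta> + (1 + 1 / \<delta>) * (\<rho> n / s2 n)"
      using ev
    proof eventually_elim
      case (elim n)
      have "\<bar>prob_space.variance (M n) (L n) / s2 n - 1\<bar> = \<bar>prob_space.variance (M n) (L n) - s2 n\<bar> / s2 n"
      proof -
        have "prob_space.variance (M n) (L n) / s2 n - 1 = (prob_space.variance (M n) (L n) - s2 n) / s2 n"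
          using elim by (simp add: diff_divide_distrib)
        then show ?thesis
          using elim by (simp only: abs_divide) simp
      qed
      also have "\<dots> \<le> (\<delta> * s2 n + (1 + 1 / \<delta>) * \<rho> n) / s2 n"
        using elim by (intro divide_right_mono var \<delta>) auto
      also have "\<dots> = \<delta> + (1 + 1 / \<delta>) * (\<rho> n / s2 n)"
        using elim by (simp add: add_divide_distrib)
      finally show ?case .
    qed
    ultimately show "\<exists>g. g \<longlonglongrightarrow> 1 * \<delta> \<and>
        (\<forall>\<^sub>F n in sequentially. \<bar>prob_space.variance (M n) (L n) / s2 n - 1\<bar> \<le> g n)"
      by auto
  qed auto

  have "conv_in_prob_const M (\<lambda>n \<omega>. U n \<omega> / prob_space.variance (M n) (L n)) 1"
    unfolding conv_in_prob_const_def
  proof (intro allI impI)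
    fix e :: real assume "0 < e"
    define e' where "e' = min e 1"
    have e': "0 < e'" "e' \<le> 1" "e' \<le> e"
      using \<open>0 < e\<close> by (auto simp: e'_def)
    have close: "\<forall>\<^sub>F n in sequentially. \<bar>prob_space.variance (M n) (L n) / s2 n - 1\<bar> < e' / 4"
      using e' by (intro order_tendstoD(2)[OF var_lim]) auto
    show "(\<lambda>n. measure (M n) {\<omega>\<in>space (M n). \<bar>U n \<omega> / prob_space.variance (M n) (L n) - 1\<bar> > e}) \<longlonglongrightarrow> 0"
    proof (rule tendsto_sandwich[OF _ _ tendsto_const])
      show "(\<lambda>n. 4 / e' * ((\<integral>\<omega>. \<bar>U n \<omega> - s2 n\<bar> \<partial>M n) / s2 n)) \<longlonglongrightarrow> 0"
        using tendsto_mult[OF tendsto_const[of "4 / e'"] E_lim] by simp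
      show "\<forall>\<^sub>F n in sequentially.
          measure (M n) {\<omega>\<in>space (M n). \<bar>U n \<omega> / prob_space.variance (M n) (L n) - 1\<bar> > e}
          \<le> 4 / e' * ((\<integral>\<omega>. \<bar>U n \<omega> - s2 n\<bar> \<partial>M n) / s2 n)"
        using ev close
      proof eventually_elim
        case (elim n)
        interpret prob_space "M n" by (rule prob)
        have [measurable]: "U n \<in> borel_measurable (M n)"
          using Uint by (rule borel_measurable_integrable)
        have "measure (M n) {\<omega>\<in>space (M n). \<bar>U n \<omega> / variance (L n) - 1\<bar> > e}
            \<le> measure (M n) {\<omega>\<in>space (M n). \<bar>U n \<omega> / variance (L n) - 1\<bar> > e'}"
          using e' by (intro finite_measure_mono) auto
        also have "\<dots> \<le> 4 / e' * ((\<integral>\<omega>. \<bar>U n \<omega> - s2 n\<bar> \<partial>M n) / s2 n)"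
          using elim e' by (intro prob_ratio_dev_le Uint) auto
        finally show ?case .
      qed
    qed auto
  qed
  moreover have "weak_conv_m (\<lambda>n. distr (M n) borel (\<lambda>\<omega>. U n \<omega> powr (- 1 / 2) * L n \<omega>)) std_normal_distribution"
  proof (rule levy_continuity)
    fix n
    have [measurable]: "U n \<in> borel_measurable (M n)" "L n \<in> borel_measurable (M n)"
      using Uint Lmeas by (auto intro: borel_measurable_integrable)
    show "real_distribution (distr (M n) borel (\<lambda>\<omega>. U n \<omega> powr (- 1 / 2) * L n \<omega>))"
      by (intro prob_space.real_distribution_distr prob) measurable
  next
    fix x :: real
    let ?\<phi> = "\<lambda>n. char (distr (M n) borel (\<lambda>\<omega>. U n \<omega> powr (- 1 / 2) * L n \<omega>)) x"
    have "(\<lambda>n. cmod (?\<phi> n - complex_of_real (exp (- (x\<^sup>2) / 2)))) \<longlonglongrightarrow> 0"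
    proof (rule tendsto_zero_if_bounded_by_small[where C="2 * \<bar>x\<bar>"])
      fix \<epsilon> :: real assume \<epsilon>: "0 < \<epsilon>" "\<epsilon> \<le> 1 / 2"
      let ?g = "\<lambda>n. 2 / \<epsilon> * (Kn n * (3 * sqrt n + 1) / s2 n) + \<bar>x\<bar> * (2 * \<epsilon> + 2 * sqrt (\<rho> n / s2 n))
          + (\<bar>x\<bar> ^ 3 * K / 6 * sqrt (1 / s2 n) + x ^ 4 * (real K)\<^sup>2 / 8 * (1 / s2 n))"
      have "?g \<longlonglongrightarrow> 2 / \<epsilon> * 0 + \<bar>x\<bar> * (2 * \<epsilon> + 2 * sqrt 0)
          + (\<bar>x\<bar> ^ 3 * K / 6 * sqrt 0 + x ^ 4 * (real K)\<^sup>2 / 8 * 0)"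
        by (intro tendsto_add tendsto_mult tendsto_const tendsto_real_sqrt U_lim \<rho>_lim s2_lim)
      moreover have "\<forall>\<^sub>F n in sequentially. cmod (?\<phi> n - complex_of_real (exp (- (x\<^sup>2) / 2))) \<le> ?g n"
        using ev
      proof eventually_elim
        case (elim n)
        then show ?case
          using chr[of n \<epsilon> x] \<epsilon> by (simp add: real_sqrt_divide)
      qed
      ultimately show "\<exists>g. g \<longlonglongrightarrow> 2 * \<bar>x\<bar> * \<epsilon> \<and>
          (\<forall>\<^sub>F n in sequentially. cmod (?\<phi> n - complex_of_real (exp (- (x\<^sup>2) / 2))) \<le> g n)"
        by (intro exI[of _ ?g]) (simp add: mult_ac)
    qed auto
    then have "(\<lambda>n. ?\<phi> n - complex_of_real (exp (- (x\<^sup>2) / 2))) \<longlonglongrightarrow> 0"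
      by (rule tendsto_norm_zero_cancel)
    then show "?\<phi> \<longlonglongrightarrow> char std_normal_distribution x"
      unfolding char_std_normal_distribution by (rule LIM_zero_cancel)
  qed (rule real_dist_normal_dist)
  ultimately show ?thesis
    unfolding L_def U_def by simp
qed

end
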